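(* Let $K\subset\mathbb R^n$, $n\geq 4$, be a convex body, let $p\in\operatorname{int}K$, let $T\in\mathrm{Gr}_{n-1}(\mathbb R^n)$ be any hyperplane, and let $\sigma:\mathrm{Gr}_{n-2}(T)\to\mathrm{Gr}_{n-1}(\mathbb R^n)$ be a continuous map such that $\sigma(H)\cap T=H$ for all $H\in\mathrm{Gr}_{n-2}(T)$. Suppose that for every $H\in\mathrm{Gr}_{n-2}(T)$ the intersection $K\cap(\sigma(H)+p)$ is invariant under a group of affine $1$-revolution of $\sigma(H)+p$ whose axis passes through $p$ and whose hyperplane of revolution is $H$. Then $K$ is a body of affine $1$-revolution, with the axis of $1$-revolution passing through $p$.
   Context: A convex body is a compact convex set with non-empty interior; $\operatorname{int}K$ is its interior. For a finite-dimensional real vector space $E$, $\mathrm{Gr}_k(E)$ is the Grassmannian of all $k$-dimensional linear subspaces of $E$ with its usual topology. Let $W$ be a $d$-dimensional real affine space with direction space $\vec W$ and let $0\le k<d$. A group of affine $k$-revolution of $W$ is a group $G$ of affine automorphisms of $W$ of the form $G=\{\varphi^{-1}\circ R_Q\circ\varphi: Q\in\mathrm O(d-k,\mathbb R)\}$, where $\varphi:W\to\mathbb R^{d-k}\times\mathbb R^k$ is an affine isomorphism and $R_Q(x,y)=(Qx,y)$. The $k$-dimensional affine subspace $\varphi^{-1}(\{0\}\times\mathbb R^k)$ of points fixed by $G$ is its (hyper)axis, and the complementary $(d-k)$-dimensional linear subspace $\vec\varphi^{-1}(\mathbb R^{d-k}\times\{0\})\subset\vec W$ (where $\vec\varphi$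 is the linear part of $\varphi$) is its hyperplane of revolution. A set $X\subset W$ is invariant under $G$ if $gX=X$ for all $g\in G$. A convex body $K\subset\mathbb R^n$ is a body of affine $k$-revolution if it is invariant under some group of affine $k$-revolution of $\mathbb R^n$; the axis of that group is called the axis of revolution of $K$. *)

theory Defs
  imports "HOL-Analysis.Analysis" "Jordan_Normal_Form.Matrix"
begin

definition convex_body :: "'a::euclidean_space set \<Rightarrow> bool"
  where "convex_body K \<longleftrightarrow> compact K \<and> convex K \<and> interior K \<noteq> {}"

definition Gr :: "nat \<Rightarrow> 'a::euclidean_space set \<Rightarrow> 'a set set"
  where "Gr k E = {V. subspace V \<and> V \<subseteq> E \<and> dim V = k}"

(* The Grassmannian is topologized by embedding it into the endomorphisms of the ambient
   space (operator norm), sending a subspace V to the orthogonal projection onto V, which is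
   closest_point V.  The following lemma shows that Blinfun is applied to a genuine bounded
   linear map. *)

lemma bounded_linear_closest_point:
  fixes V :: "'a::euclidean_space set"
  assumes V: "subspace V"
  shows "bounded_linear (closest_point V)"
proof -
  have cl: "closed V" and cx: "convex V" and ne: "V \<noteq> {}"
    using V closed_subspace subspace_imp_convex subspace_0 by blast+
  have mem: "closest_point V x \<in> V" for x
    using closest_point_in_set[OF cl ne] .
  have orth: "(x - closest_point V x) \<bullet> v = 0" if "v \<in> V" for x v
  proof -
    have le: "(x - closest_point V x) \<bullet> w \<le> 0" if "w \<in> V" for w
      using closest_point_dot[OF cx cl subspace_add[OF V mem that], of x x] by simp
    show ?thesis
      using le[OF that] le[OF subspace_neg[OF V that]] by (simp add: inner_minus_right)
  qed
  have uniq: "closest_point V x = y" if y: "y \<in> V" and o: "\<And>v. v \<in> V \<Longrightarrow> (x - y) \<bullet> v = 0" for x y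
  proof -
    let ?z = "closest_point V x - y"
    have z: "?z \<in> V"
      using subspace_diff[OF V mem y] .
    have "?z \<bullet> ?z = (x - y) \<bullet> ?z - (x - closest_point V x) \<bullet> ?z"
      by (simp add: inner_diff_left)
    also have "\<dots> = 0"
      using o[OF z] orth[OF z] by simp
    finally show ?thesis by simp
  qed
  have "linear (closest_point V)"
  proof (rule linearI)
    fix x y :: 'a and c :: real
    show "closest_point V (x + y) = closest_point V x + closest_point V y"
    proof (rule uniq)
      show "closest_point V x + closest_point V y \<in> V"
        using subspace_add[OF V mem mem] .
      fix v assume v: "v \<in> V"
      show "(x + y - (closest_point V x + closest_point V y)) \<bullet> v = 0"
        using orth[OF v, of x] orth[OF v, of y] by (simp add: inner_diff_left inner_add_left)
    qed
    show "closest_point V (c *\<^sub>R x) = c *\<^sub>R closest_point V x"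
    proof (rule uniq)
      show "c *\<^sub>R closest_point V x \<in> V"
        using subspace_scale[OF V mem] .
      fix v assume v: "v \<in> V"
      show "(c *\<^sub>R x - c *\<^sub>R closest_point V x) \<bullet> v = 0"
        using orth[OF v, of x] by (simp add: inner_diff_left)
    qed
  qed
  then show ?thesis
    by (rule linear_conv_bounded_linear[THEN iffD1])
qed

definition grassmannian :: "nat \<Rightarrow> 'a::euclidean_space set \<Rightarrow> 'a set topology"
  where "grassmannian k E = pullback_topology (Gr k E) (\<lambda>V. Blinfun (closest_point V)) euclidean"

(* The dimension d - k is a term, so the model space R^(d-k) x R^k is rendered by
   dimension-indexed vectors, carrier_vec (d-k) and carrier_vec k. *)

definition orthogonal_group :: "nat \<Rightarrow> real mat set"
  where "orthogonal_group m = {Q \<in> carrier_mat m m. transpose_mat Q * Q = 1\<^sub>m m}"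

definition affine_vec_on :: "'a::euclidean_space set \<Rightarrow> ('a \<Rightarrow> real vec) \<Rightarrow> bool"
  where "affine_vec_on W f \<longleftrightarrow>
    (\<forall>x\<in>W. \<forall>y\<in>W. \<forall>t. f ((1 - t) *\<^sub>R x + t *\<^sub>R y) = (1 - t) \<cdot>\<^sub>v f x + t \<cdot>\<^sub>v f y)"

definition affine_iso ::
    "'a::euclidean_space set \<Rightarrow> nat \<Rightarrow> nat \<Rightarrow> ('a \<Rightarrow> real vec \<times> real vec) \<Rightarrow> bool"
  where "affine_iso W m k \<phi> \<longleftrightarrow>
    bij_betw \<phi> W (carrier_vec m \<times> carrier_vec k) \<and>
    affine_vec_on W (fst \<circ> \<phi>) \<and> affine_vec_on W (snd \<circ> \<phi>)"

definition rotate_fst :: "real mat \<Rightarrow> real vec \<times> real vec \<Rightarrow> real vec \<times> real vec"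
  where "rotate_fst Q = (\<lambda>(x, y). (Q *\<^sub>v x, y))"

(* affine_revolution_group k W G A L: G is a group of affine k-revolution of the affine
   subspace W, with axis A and with hyperplane of revolution L.  Self-maps of W are
   represented by functions on the ambient space, restricted to W.  The axis is the preimage
   of {0} x R^k; as the linear part of phi maps u - v to phi u - phi v, the preimage of
   R^(d-k) x {0} under it consists of the differences below. *)

definition affine_revolution_group ::
    "nat \<Rightarrow> 'a::euclidean_space set \<Rightarrow> ('a \<Rightarrow> 'a) set \<Rightarrow> 'a set \<Rightarrow> 'a set \<Rightarrow> bool"
  where "affine_revolution_group k W G A L \<longleftrightarrow>
    affine W \<and> int k < aff_dim W \<and>
    (\<exists>\<phi>. let m = nat (aff_dim W) - k in
      affine_iso W m k \<phi> \<and>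
      G = {restrict (the_inv_into W \<phi> \<circ> rotate_fst Q \<circ> \<phi>) W | Q. Q \<in> orthogonal_group m} \<and>
      A = {w \<in> W. fst (\<phi> w) = 0\<^sub>v m} \<and>
      L = {u - v | u v. u \<in> W \<and> v \<in> W \<and> snd (\<phi> u) = snd (\<phi> v)})"

definition invariant_under :: "('a \<Rightarrow> 'a) set \<Rightarrow> 'a set \<Rightarrow> bool"
  where "invariant_under G X \<longleftrightarrow> (\<forall>g\<in>G. g ` X = X)"

(* K is a body of affine k-revolution with axis of revolution A *)
definition affine_revolution_body :: "nat \<Rightarrow> 'a::euclidean_space set \<Rightarrow> 'a set \<Rightarrow> bool"
  where "affine_revolution_body k K A \<longleftrightarrow>
    convex_body K \<and> (\<exists>G L. affine_revolution_group k UNIV G A L \<and> invariant_under G K)"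

end

theory Submission
  imports Defs "Jordan_Normal_Form.Determinant"
begin

text \<open>
Take p as the origin, let T be the orthogonal complement of a unit vector t, and call
x \<bullet> t the level of x. By hypothesis the section of K by \<sigma>(H) has an axis of revolution; let a(H) be
the point of level 1 on it. The group of the section acts on H as the full orthogonal group of
some inner product, and orthogonal groups are transitive on spheres. So for every level s, whether
s a(H) + x with x \<in> H lies in K depends only on the length of x in that inner product. This is all
that is used about the groups.

The forms. At level 0 the section is K \<inter> H, which is therefore the unit ball of a suitably scaled
inner product on H. The squared gauge of K on T thus restricts to a quadratic form on every
hyperplane of T. Since dim T \<ge> 3, any two vectors of T lie in such a hyperplane, and the
Jordan--von Neumann construction yields one inner product D on T that induces all of these forms
(\<open>ellipsoid_from_sections\<close>).

The axes. Two sections \<sigma>(H) and \<sigma>(H') share a point b of level 1. For h \<in> H \<inter> H', each of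
the two groups of revolution contains the reflection in the direction h, and both reflections
preserve the bounded nonempty piece of the line s b + \<real>h in K, for small s > 0. Their composition
is a translation, so it is trivial, and this says D(a(H) - a(H'), h) = 0 (\<open>axes_agree\<close>).
Hence h \<mapsto> D(a(H) - t, h), with H any hyperplane of T containing h, is well defined; it is linear
because any two vectors of T share a hyperplane. So it is represented by a vector of T, which added
to t gives one point c of level 1 such that a(H) - c is D-orthogonal to H for every H (\<open>common_axis\<close>).

The orbits. Let x, y \<in> T have the same D-length and let x0 = s c + x. If some H contains x - y and
x0 \<in> \<sigma>(H), then s c + x and s c + y both lie in \<sigma>(H), at the same distance from its axis, so one
lies in K iff the other does. Such an H exists by continuity of \<sigma>: let the normal m of H in T turn
through a half-turn inside the orthogonal complement of x - y, which is possible as dim T \<ge> 3.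
The inner product of m with the component of x0 normal to \<sigma>(H) changes sign, and it vanishes only
if x0 \<in> \<sigma>(H) (\<open>section_through\<close>). Therefore K is invariant under the D-orthogonal group of T fixing the
line through p in direction c pointwise, which is a group of affine 1-revolution.
\<close>

(* From here on, the infix dot is the inner product of the ambient space
   and $ is the coordinate of a model vector. *)
no_notation scalar_prod (infix \<open>\<bullet>\<close> 70)
no_notation vec_nth (infixl \<open>$\<close> 90)

section \<open>Orthogonal transformations of the model space\<close>

lemma orthogonal_group_transpose:
  assumes "Q \<in> orthogonal_group m"
  shows "Q * transpose_mat Q = 1\<^sub>m m"
  using assms mat_mult_left_right_inverse[of "transpose_mat Q" m Q]
  by (auto simp: orthogonal_group_def)

lemma orthogonal_group_scalar_prod:
  assumes Q: "Q \<in> orthogonal_group m" and v: "v \<in> carrier_vec m"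
  shows "scalar_prod (Q *\<^sub>v v) (Q *\<^sub>v v) = scalar_prod v v"
proof -
  have c: "Q \<in> carrier_mat m m" and o: "transpose_mat Q * Q = 1\<^sub>m m"
    using Q by (auto simp: orthogonal_group_def)
  have "scalar_prod (Q *\<^sub>v v) (Q *\<^sub>v v) = scalar_prod (transpose_mat Q *\<^sub>v (Q *\<^sub>v v)) v"
    using transpose_vec_mult_scalar[OF c v, of "Q *\<^sub>v v"] c v by auto
  also have "transpose_mat Q *\<^sub>v (Q *\<^sub>v v) = v"
    using assoc_mult_mat_vec[of "transpose_mat Q" m m Q m v] c v o by auto
  finally show ?thesis .
qed

text \<open>If the two vectors differ, the Householder reflection in their difference u exchanges them; the
equality of lengths is what makes 2 (u \<bullet> v) equal to u \<bullet> u.\<close>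

lemma orthogonal_group_transitive_on_spheres:
  assumes v: "v \<in> carrier_vec m" and w: "w \<in> carrier_vec m"
    and vw: "scalar_prod v v = scalar_prod w w"
  shows "\<exists>Q\<in>orthogonal_group m. Q *\<^sub>v v = w"
proof (cases "v = w")
  case True
  then show ?thesis
    using v by (intro bexI[of _ "1\<^sub>m m"]) (auto simp: orthogonal_group_def)
next
  case False
  define u where "u i = v $ i - w $ i" for i
  define N where "N = (\<Sum>i=0..<m. u i * u i)"
  have "\<exists>i<m. u i \<noteq> 0"
    using False v w by (auto simp: u_def vec_eq_iff)
  then have "N > 0"
    unfolding N_def by (auto intro!: sum_pos2 simp: zero_less_mult_iff)
  have uv: "2 * (\<Sum>i=0..<m. u i * v $ i) = N"
    using vw v w unfolding N_def u_def scalar_prod_def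
    by (simp add: algebra_simps sum.distrib sum_subtractf sum_distrib_left)
  define Q where "Q = mat m m (\<lambda>(i, j). (if i = j then 1 else 0) - 2 * u i * u j / N)"
  have Qc: "Q \<in> carrier_mat m m"
    by (simp add: Q_def)
  have "transpose_mat Q * Q = 1\<^sub>m m"
  proof (rule eq_matI)
    fix i j assume "i < dim_row (1\<^sub>m m)" "j < dim_col (1\<^sub>m m)"
    then have i: "i < m" and j: "j < m" by auto
    have "(transpose_mat Q * Q) $$ (i, j) =
      (\<Sum>k=0..<m. ((if k = i then 1 else 0) - 2 * u k * u i / N) * ((if k = j then 1 else 0) - 2 * u k * u j / N))"
      using i j by (auto simp: Q_def scalar_prod_def)
    also have "\<dots> = (\<Sum>k=0..<m. (if k = i then (if i = j then 1 else 0) else 0)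
       - (if k = i then 2 * u i * u j / N else 0) - (if k = j then 2 * u i * u j / N else 0)
       + (4 * u i * u j / N^2) * (u k * u k))"
      by (intro sum.cong) (auto simp: algebra_simps power2_eq_square)
    also have "\<dots> = (if i = j then 1 else 0) - 2 * u i * u j / N - 2 * u i * u j / N + (4 * u i * u j / N^2) * N"
      using i j unfolding N_def sum_distrib_left[symmetric] sum.distrib sum_subtractf by simp
    also have "\<dots> = (if i = j then 1 else 0)"
      using \<open>N > 0\<close> by (simp add: power2_eq_square)
    finally show "(transpose_mat Q * Q) $$ (i, j) = 1\<^sub>m m $$ (i, j)"
      using i j by simp
  qed (use Qc in auto)
  moreover have "Q *\<^sub>v v = w"
  proof (rule eq_vecI)
    fix i assume "i < dim_vec w"
    then have i: "i < m" using w by auto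
    have "(Q *\<^sub>v v) $ i = (\<Sum>k=0..<m. ((if i = k then 1 else 0) - 2 * u i * u k / N) * v $ k)"
      using i v by (auto simp: Q_def scalar_prod_def)
    also have "\<dots> = (\<Sum>k=0..<m. (if i = k then v $ i else 0) - (2 * u i / N) * (u k * v $ k))"
      by (intro sum.cong) (auto simp: algebra_simps)
    also have "\<dots> = v $ i - (2 * u i / N) * (\<Sum>k=0..<m. u k * v $ k)"
      using i unfolding sum_distrib_left[symmetric] sum_subtractf by simp
    also have "\<dots> = v $ i - u i"
      using \<open>N > 0\<close> uv by (simp add: field_simps)
    finally show "(Q *\<^sub>v v) $ i = w $ i"
      by (simp add: u_def)
  qed (use Qc w in auto)
  ultimately show ?thesis
    using Qc by (auto simp: orthogonal_group_def)
qed

section \<open>Linear subspaces and hyperplanes\<close>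

lemma linear_closest_point:
  fixes V :: "'a::euclidean_space set"
  assumes "subspace V"
  shows "linear (closest_point V)"
  using bounded_linear_closest_point[OF assms] by (simp add: linear_conv_bounded_linear)

lemma closest_point_in_subspace:
  fixes V :: "'a::euclidean_space set"
  assumes "subspace V"
  shows "closest_point V x \<in> V"
  using assms by (intro closest_point_in_set) (auto simp: closed_subspace dest: subspace_0)

text \<open>The formula that makes orthogonal projections, and hence the topology of the Grassmannian,
computable.\<close>

lemma closest_point_subspace_eq:
  fixes V :: "'a::euclidean_space set"
  assumes V: "subspace V" and y: "y \<in> V" and orth: "\<And>v. v \<in> V \<Longrightarrow> (x - y) \<bullet> v = 0"
  shows "closest_point V x = y"
proof -
  have "dist x y \<le> dist x z" if z: "z \<in> V" for z
  proof -
    have "(x - z) \<bullet> (x - z) = (x - y) \<bullet> (x - y) + 2 * ((x - y) \<bullet> (y - z)) + (y - z) \<bullet> (y - z)"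
      by (simp add: inner_diff_left inner_diff_right inner_commute)
    also have "(x - y) \<bullet> (y - z) = 0"
      using orth[of "y - z"] V y z by (simp add: subspace_diff)
    finally show ?thesis
      by (simp add: dist_norm norm_le)
  qed
  then show ?thesis
    using closest_point_unique[of V y x] V y by (metis closed_subspace subspace_imp_convex)
qed

lemma hyperplane_in_Gr:
  fixes T :: "'a::euclidean_space set"
  assumes T: "subspace T" and dT: "dim T = Suc k" and w: "w \<in> T" "w \<noteq> 0"
  shows "{x \<in> T. x \<bullet> w = 0} \<in> Gr k T"
proof -
  let ?H = "{x \<in> T. x \<bullet> w = 0}"
  have H: "subspace ?H"
    using T unfolding subspace_def by (auto simp: inner_add_left)
  have "span (insert w ?H) = T"
  proof
    show "span (insert w ?H) \<subseteq> T"
      using w T by (intro span_minimal) auto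
    show "T \<subseteq> span (insert w ?H)"
    proof
      fix x assume x: "x \<in> T"
      define c where "c = (x \<bullet> w) / (w \<bullet> w)"
      have "x - c *\<^sub>R w \<in> ?H"
        using x w T by (auto simp: c_def inner_diff_left subspace_diff subspace_scale)
      then have "x - c *\<^sub>R w \<in> span (insert w ?H)" by (auto intro: span_base)
      moreover have "c *\<^sub>R w \<in> span (insert w ?H)"
        by (auto intro: span_base span_scale)
      ultimately have "(x - c *\<^sub>R w) + c *\<^sub>R w \<in> span (insert w ?H)"
        by (rule span_add)
      then show "x \<in> span (insert w ?H)" by simp
    qed
  qed
  moreover have "w \<notin> span ?H"
    using w H by (auto simp: span_eq_iff[THEN iffD2])
  ultimately have "dim T = dim ?H + 1"
    using dim_insert[of w ?H] dim_span[of "insert w ?H"] by (simp only: if_False)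
  then show ?thesis
    using H dT by (auto simp: Gr_def)
qed

lemma hyperplane_unit_normal:
  fixes T :: "'a::euclidean_space set"
  assumes T: "subspace T" and dT: "Suc (dim T) = DIM('a)"
  obtains t where "norm t = 1" "T = {x. x \<bullet> t = 0}"
proof -
  obtain w where w: "w \<noteq> 0" "\<And>y. y \<in> span T \<Longrightarrow> real_inner_class.orthogonal w y"
    using orthogonal_to_subspace_exists[of T] dT by auto
  have G: "{y \<in> UNIV. y \<bullet> w = 0} \<in> Gr (dim T) UNIV"
    using w dT by (intro hyperplane_in_Gr) auto
  have "T = {y \<in> UNIV. y \<bullet> w = 0}"
    using w T G by (intro subspace_dim_equal)
      (auto simp: Gr_def real_inner_class.orthogonal_def inner_commute span_base)
  then show ?thesis
    using that[of "w /\<^sub>R norm w"] w by simp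
qed

lemma unit_normal_to_pair:
  fixes T :: "'a::euclidean_space set"
  assumes T: "subspace T" and dT: "dim T > 2" and x: "x \<in> T" and y: "y \<in> T"
  obtains w where "w \<in> T" "norm w = 1" "x \<bullet> w = 0" "y \<bullet> w = 0"
proof -
  have sub: "span {x, y} \<subseteq> span T"
    using x y by (intro span_mono) auto
  have "dim {x, y} \<le> 2"
    using dim_le_card'[of "{x, y}"] card_insert_le_m1[of 2 "{y}" x] by simp
  then have "span {x, y} \<noteq> span T"
    using dT by (metis dim_span not_le)
  then obtain w where w: "w \<noteq> 0" "w \<in> span T" "\<And>z. z \<in> span {x, y} \<Longrightarrow> real_inner_class.orthogonal w z"
    using orthogonal_to_subspace_exists_gen[of "{x, y}" T] sub by blast
  have "w \<in> T" using w T by (simp add: span_eq_iff[THEN iffD2])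
  moreover have "x \<bullet> w = 0" "y \<bullet> w = 0"
    using w(3)[of x] w(3)[of y] by (auto simp: span_base real_inner_class.orthogonal_def inner_commute)
  ultimately show ?thesis
    using that[of "w /\<^sub>R norm w"] w(1) T by (simp add: subspace_scale)
qed

text \<open>The source of all gluing: a property of at most two vectors of T that holds in every hyperplane of
T holds in T.\<close>

lemma pair_in_hyperplane:
  fixes T :: "'a::euclidean_space set"
  assumes T: "subspace T" and dT: "dim T = Suc k" and k: "k \<ge> 2" and x: "x \<in> T" and y: "y \<in> T"
  obtains H where "H \<in> Gr k T" "x \<in> H" "y \<in> H"
proof -
  obtain w where w: "w \<in> T" "norm w = 1" "x \<bullet> w = 0" "y \<bullet> w = 0"
    using unit_normal_to_pair[OF T _ x y] dT k by auto
  moreover have "w \<noteq> 0" using w by auto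
  ultimately show ?thesis
    using that[of "{z \<in> T. z \<bullet> w = 0}"] hyperplane_in_Gr[OF T dT, of w] x y by auto
qed

section \<open>Quadratic forms\<close>

text \<open>Quadratic on planes implies quadratic. Homogeneity of the polarization B can be read off in one
plane; additivity involves three vectors and follows from the
parallelogram law applied to x + z, y + z and to x - z, y - z.\<close>

lemma jordan_von_neumann:
  fixes q :: "'a::real_vector \<Rightarrow> real"
  assumes planes: "\<And>x y. \<exists>\<beta>. \<forall>s t. q (s *\<^sub>R x + t *\<^sub>R y) = s\<^sup>2 * q x + 2 * s * t * \<beta> + t\<^sup>2 * q y"
  obtains B where "bilinear B" "\<And>x y. B x y = B y x" "\<And>x. B x x = q x"
proof -
  define B where "B x y = (q (x + y) - q (x - y)) / 4" for x y
  have plane: "q (s *\<^sub>R x + t *\<^sub>R y) = s\<^sup>2 * q x + 2 * s * t * B x y + t\<^sup>2 * q y" for s t x y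
  proof -
    obtain \<beta> where \<beta>: "\<And>s t. q (s *\<^sub>R x + t *\<^sub>R y) = s\<^sup>2 * q x + 2 * s * t * \<beta> + t\<^sup>2 * q y"
      using planes[of x y] by blast
    have "B x y = \<beta>"
      using \<beta>[of 1 1] \<beta>[of 1 "-1"] by (simp add: B_def)
    then show ?thesis using \<beta> by simp
  qed
  have parallelogram: "q (x + y) + q (x - y) = 2 * q x + 2 * q y" for x y
    using plane[of 1 x 1 y] plane[of 1 x "-1" y] by simp
  have sym: "B x y = B y x" for x y
    using plane[of 1 x 1 y] plane[of 1 y 1 x] by (simp add: add.commute)
  have scale: "B x (c *\<^sub>R y) = c * B x y" for x y c
    using plane[of 1 x c y] plane[of 1 x "-c" y] by (simp add: B_def)
  have add: "B (x + y) z = B x z + B y z" for x y z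
  proof -
    have eqs: "(x + z) + (y + z) = (x + y) + 2 *\<^sub>R z" "(x + z) - (y + z) = x - y"
      "(x - z) + (y - z) = (x + y) - 2 *\<^sub>R z" "(x - z) - (y - z) = x - y"
      by (simp_all add: algebra_simps scaleR_2)
    have "2 * q (x + z) + 2 * q (y + z) - (2 * q (x - z) + 2 * q (y - z))
        = q ((x + y) + 2 *\<^sub>R z) - q ((x + y) - 2 *\<^sub>R z)"
      using parallelogram[of "x + z" "y + z"] parallelogram[of "x - z" "y - z"] unfolding eqs by linarith
    also have "\<dots> = 8 * B (x + y) z"
      using scale[of "x + y" 2 z] by (simp only: B_def) argo
    finally show ?thesis unfolding B_def by argo
  qed
  have lin: "linear (\<lambda>x. B x z)" for z
  proof (rule linearI)
    show "B (x + y) z = B x z + B y z" for x y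
      by (rule add)
    show "B (c *\<^sub>R x) z = c *\<^sub>R B x z" for c x
      using scale[of z c x] by (simp add: sym[of _ z])
  qed
  have "bilinear B"
    unfolding bilinear_def using lin lin sym by (metis (no_types, lifting) ext)
  moreover have "B x x = q x" for x
    using plane[of 1 x 0 x] plane[of 1 x 1 x] plane[of 2 x 0 x] plane[of 0 x 0 x]
    by (simp add: B_def scaleR_2)
  ultimately show ?thesis using sym that by blast
qed

lemma bilinear_quadratic_expand:
  fixes B :: "'a::real_vector \<Rightarrow> 'a \<Rightarrow> real"
  assumes B: "bilinear B" and sym: "B y x = B x y"
  shows "B (s *\<^sub>R x + t *\<^sub>R y) (s *\<^sub>R x + t *\<^sub>R y) = s\<^sup>2 * B x x + 2 * s * t * B x y + t\<^sup>2 * B y y"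
proof -
  have "B (s *\<^sub>R x + t *\<^sub>R y) (s *\<^sub>R x + t *\<^sub>R y)
      = s * (s * B x x + t * B x y) + t * (s * B y x + t * B y y)"
    by (simp add: bilinear_ladd[OF B] bilinear_radd[OF B] bilinear_lmul[OF B] bilinear_rmul[OF B]
        distrib_left)
  also have "\<dots> = s\<^sup>2 * B x x + 2 * s * t * B x y + t\<^sup>2 * B y y"
    by (simp only: sym power2_eq_square) (simp add: algebra_simps)
  finally show ?thesis .
qed

lemma bilinear_left_sum:
  fixes B :: "'a::real_vector \<Rightarrow> 'a \<Rightarrow> real"
  assumes B: "bilinear B"
  shows "B (\<Sum>i\<in>I. u i *\<^sub>R e i) y = (\<Sum>i\<in>I. u i * B (e i) y)"
proof -
  have lin: "linear (\<lambda>x. B x y)" using B by (simp add: bilinear_def)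
  show ?thesis
    by (simp only: linear_sum[OF lin] linear_scale[OF lin] real_scaleR_def)
qed

text \<open>The form may be degenerate off T, so the induction passes to complements within T.\<close>

lemma gram_schmidt:
  fixes T :: "'a::euclidean_space set" and B :: "'a \<Rightarrow> 'a \<Rightarrow> real"
  assumes "subspace T" and "dim T = m" and B: "bilinear B" and sym: "\<And>x y. B x y = B y x"
    and pos: "\<And>x. x \<in> T \<Longrightarrow> x \<noteq> 0 \<Longrightarrow> B x x > 0"
  obtains e where "\<And>i. i < m \<Longrightarrow> e i \<in> T"
    "\<And>i j. i < m \<Longrightarrow> j < m \<Longrightarrow> B (e i) (e j) = (if i = j then 1 else 0)"
    "\<And>x. x \<in> T \<Longrightarrow> x = (\<Sum>i<m. B (e i) x *\<^sub>R e i)"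
proof -
  have "\<exists>e. (\<forall>i<m. e i \<in> T) \<and> (\<forall>i<m. \<forall>j<m. B (e i) (e j) = (if i = j then 1 else 0)) \<and>
      (\<forall>x\<in>T. x = (\<Sum>i<m. B (e i) x *\<^sub>R e i))"
    using assms(1,2) pos
  proof (induction m arbitrary: T)
    case 0
    then show ?case by auto
  next
    case (Suc m)
    have "T \<noteq> {0}" "0 \<in> T"
      using Suc.prems by (auto simp: subspace_0)
    then obtain w where w: "w \<in> T" "w \<noteq> 0" by blast
    define v where "v = (1 / sqrt (B w w)) *\<^sub>R w"
    have vT: "v \<in> T"
      using w Suc.prems by (simp add: v_def subspace_scale)
    have vv: "B v v = 1"
      using Suc.prems(3)[OF w] by (simp add: v_def bilinear_lmul[OF B] bilinear_rmul[OF B])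
    define T' where "T' = {x \<in> T. B v x = 0}"
    have T': "subspace T'"
      using Suc.prems(1) unfolding T'_def subspace_def
      by (auto simp: bilinear_radd[OF B] bilinear_rmul[OF B] bilinear_rzero[OF B])
    have proj: "x - B v x *\<^sub>R v \<in> T'" if "x \<in> T" for x
      using that Suc.prems(1) vT vv
      by (auto simp: T'_def bilinear_rsub[OF B] bilinear_rmul[OF B] subspace_diff subspace_scale)
    have "span (insert v T') = T"
    proof
      show "span (insert v T') \<subseteq> T"
        using vT Suc.prems(1) by (intro span_minimal) (auto simp: T'_def)
      show "T \<subseteq> span (insert v T')"
      proof
        fix x assume "x \<in> T"
        then have "x - B v x *\<^sub>R v \<in> span (insert v T')"
          using proj by (auto intro: span_base)
        moreover have "B v x *\<^sub>R v \<in> span (insert v T')"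
          by (auto intro: span_base span_scale)
        ultimately have "(x - B v x *\<^sub>R v) + B v x *\<^sub>R v \<in> span (insert v T')"
          by (rule span_add)
        then show "x \<in> span (insert v T')" by simp
      qed
    qed
    moreover have "v \<notin> span T'"
      using vv T' by (auto simp: T'_def span_eq_iff[THEN iffD2])
    ultimately have "dim T = dim T' + 1"
      using dim_insert[of v T'] dim_span[of "insert v T'"] by (simp only: if_False)
    then have "dim T' = m" using Suc.prems by simp
    moreover have "\<And>x. x \<in> T' \<Longrightarrow> x \<noteq> 0 \<Longrightarrow> B x x > 0"
      using Suc.prems by (auto simp: T'_def)
    ultimately obtain e where e: "\<forall>i<m. e i \<in> T'"
      "\<forall>i<m. \<forall>j<m. B (e i) (e j) = (if i = j then 1 else 0)"
      "\<forall>x\<in>T'. x = (\<Sum>i<m. B (e i) x *\<^sub>R e i)"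
      using Suc.IH[OF T'] by blast
    define e' where "e' = e(m := v)"
    have eq: "B (e i) v = 0" "B v (e i) = 0" if "i < m" for i
      using e(1) that sym by (auto simp: T'_def)
    have "x = (\<Sum>i<Suc m. B (e' i) x *\<^sub>R e' i)" if "x \<in> T" for x
    proof -
      have "x - B v x *\<^sub>R v = (\<Sum>i<m. B (e i) (x - B v x *\<^sub>R v) *\<^sub>R e i)"
        using proj[OF that] e(3) by blast
      also have "\<dots> = (\<Sum>i<m. B (e' i) x *\<^sub>R e' i)"
        using eq by (intro sum.cong) (auto simp: e'_def bilinear_rsub[OF B] bilinear_rmul[OF B])
      finally have "x = (\<Sum>i<m. B (e' i) x *\<^sub>R e' i) + B v x *\<^sub>R v"
        by (simp add: diff_eq_eq)
      then show ?thesis by (simp add: e'_def)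
    qed
    moreover have "\<forall>i<Suc m. e' i \<in> T"
      using e(1) vT by (auto simp: e'_def T'_def less_Suc_eq)
    moreover have "\<forall>i<Suc m. \<forall>j<Suc m. B (e' i) (e' j) = (if i = j then 1 else 0)"
      using e(2) eq vv by (auto simp: e'_def less_Suc_eq)
    ultimately show ?case by blast
  qed
  then show ?thesis using that by blast
qed

section \<open>A section with an affine axis of revolution\<close>

text \<open>Composing with the orthogonal projection onto V makes the linear part a linear map of the whole
ambient space, so that no later computation has to check membership in V.\<close>

lemma affine_real_linear_part:
  fixes h :: "'a::euclidean_space \<Rightarrow> real"
  assumes V: "subspace V"
    and h: "\<And>x y t. x \<in> V \<Longrightarrow> y \<in> V \<Longrightarrow> h ((1 - t) *\<^sub>R x + t *\<^sub>R y) = (1 - t) * h x + t * h y"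
  obtains l where "linear l" "\<And>x. x \<in> V \<Longrightarrow> l x = h x - h 0"
proof -
  let ?P = "closest_point V"
  note P = linear_closest_point[OF V]
  note PV = closest_point_in_subspace[OF V]
  have scale: "h (c *\<^sub>R x) = c * h x + (1 - c) * h 0" if "x \<in> V" for c x
    using h[OF subspace_0[OF V] that, of c] by simp
  have add: "h (x + y) = h x + h y - h 0" if "x \<in> V" "y \<in> V" for x y
    using h[of "2 *\<^sub>R x" "2 *\<^sub>R y" "1/2"] scale[of x 2] scale[of y 2] that V
    by (simp add: subspace_scale) argo
  have "linear (\<lambda>x. h (?P x) - h 0)"
    by (rule linearI)
      (simp_all add: linear_add[OF P] linear_scale[OF P] add[OF PV PV] scale[OF PV] algebra_simps)
  moreover have "?P x = x" if "x \<in> V" for x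
    using that by (rule closest_point_self)
  ultimately show ?thesis
    using that[of "\<lambda>x. h (?P x) - h 0"] by simp
qed

text \<open>Coordinates of a group of revolution, centred at p: the f i are the rotated coordinates and g is
the coordinate along the axis, shifted so that it vanishes at p. The last conclusion is where the
group enters: two points with equal g and equal distance from the axis are in one orbit.\<close>

lemma revolution_coordinates:
  fixes V :: "'a::euclidean_space set"
  assumes V: "subspace V" and dV: "dim V = Suc m"
    and rev: "affine_revolution_group 1 ((\<lambda>x. x + p) ` V) G A H" and pA: "p \<in> A"
    and inv: "invariant_under G (K \<inter> (\<lambda>x. x + p) ` V)"
  obtains f :: "nat \<Rightarrow> 'a \<Rightarrow> real" and g :: "'a \<Rightarrow> real"
  where "\<And>i. i < m \<Longrightarrow> linear (f i)" "linear g"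
    "\<And>x. x \<in> V \<Longrightarrow> \<forall>i<m. f i x = 0 \<Longrightarrow> g x = 0 \<Longrightarrow> x = 0"
    "\<And>u c. \<exists>x\<in>V. (\<forall>i<m. f i x = u i) \<and> g x = c"
    "H = {x \<in> V. g x = 0}"
    "\<And>x y. x \<in> V \<Longrightarrow> y \<in> V \<Longrightarrow> (\<Sum>i<m. f i x * f i x) = (\<Sum>i<m. f i y * f i y) \<Longrightarrow>
      g x = g y \<Longrightarrow> x + p \<in> K \<Longrightarrow> y + p \<in> K"
proof -
  let ?W = "(\<lambda>x. x + p) ` V"
  have "aff_dim ?W = aff_dim V"
    using aff_dim_translation_eq[of p V] by (simp add: add.commute)
  then have dW: "nat (aff_dim ?W) - 1 = m"
    using aff_dim_subspace[OF V] dV by simp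
  obtain \<phi> where iso: "affine_iso ?W m 1 \<phi>"
    and G: "G = {restrict (the_inv_into ?W \<phi> \<circ> rotate_fst Q \<circ> \<phi>) ?W | Q. Q \<in> orthogonal_group m}"
    and A: "A = {w \<in> ?W. fst (\<phi> w) = 0\<^sub>v m}"
    and H: "H = {u - v | u v. u \<in> ?W \<and> v \<in> ?W \<and> snd (\<phi> u) = snd (\<phi> v)}"
    using rev unfolding affine_revolution_group_def Let_def dW by blast
  have bij: "bij_betw \<phi> ?W (carrier_vec m \<times> carrier_vec 1)"
    using iso by (simp add: affine_iso_def)
  have car: "fst (\<phi> (x + p)) \<in> carrier_vec m" "snd (\<phi> (x + p)) \<in> carrier_vec 1" if "x \<in> V" for x
    using bij_betw_apply[OF bij, of "x + p"] that by (auto simp: mem_Times_iff)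
  have comb: "(1 - t) *\<^sub>R (x + p) + t *\<^sub>R (y + p) = ((1 - t) *\<^sub>R x + t *\<^sub>R y) + p" for x y t
    by (simp add: algebra_simps)
  have aff: "fst (\<phi> (((1 - t) *\<^sub>R x + t *\<^sub>R y) + p)) = (1 - t) \<cdot>\<^sub>v fst (\<phi> (x + p)) + t \<cdot>\<^sub>v fst (\<phi> (y + p))"
    "snd (\<phi> (((1 - t) *\<^sub>R x + t *\<^sub>R y) + p)) = (1 - t) \<cdot>\<^sub>v snd (\<phi> (x + p)) + t \<cdot>\<^sub>v snd (\<phi> (y + p))"
    if "x \<in> V" "y \<in> V" for x y t
    using iso that unfolding affine_iso_def affine_vec_on_def comb[symmetric] by auto
  have p0: "fst (\<phi> (0 + p)) = 0\<^sub>v m"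
    using pA A by simp
  have "\<exists>l. linear l \<and> (\<forall>x\<in>V. l x = fst (\<phi> (x + p)) $ i)" if i: "i < m" for i
  proof -
    obtain l where "linear l" "\<And>x. x \<in> V \<Longrightarrow> l x = fst (\<phi> (x + p)) $ i - fst (\<phi> (0 + p)) $ i"
      using affine_real_linear_part[OF V, of "\<lambda>x. fst (\<phi> (x + p)) $ i"] aff(1) car(1) i
      by (smt (verit, ccfv_SIG) carrier_vecD index_add_vec(1) index_smult_vec(1) index_smult_vec(2))
    then show ?thesis using p0 i by auto
  qed
  then obtain f where flin: "\<And>i. i < m \<Longrightarrow> linear (f i)"
    and f: "\<And>i x. i < m \<Longrightarrow> x \<in> V \<Longrightarrow> f i x = fst (\<phi> (x + p)) $ i"
    by metis
  define c0 where "c0 = snd (\<phi> (0 + p)) $ 0"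
  obtain g where glin: "linear g" and g: "\<And>x. x \<in> V \<Longrightarrow> g x = snd (\<phi> (x + p)) $ 0 - c0"
    using affine_real_linear_part[OF V, of "\<lambda>x. snd (\<phi> (x + p)) $ 0"] aff(2) car(2)
    unfolding c0_def
    by (smt (verit, ccfv_SIG) carrier_vecD index_add_vec(1) index_smult_vec(1) index_smult_vec(2) less_one)
  have snd_eq: "snd (\<phi> (x + p)) = snd (\<phi> (y + p)) \<longleftrightarrow> g x = g y" if "x \<in> V" "y \<in> V" for x y
    using car(2)[OF that(1)] car(2)[OF that(2)] g[OF that(1)] g[OF that(2)] by (auto simp: vec_eq_iff)
  have fst_eq: "fst (\<phi> (x + p)) = fst (\<phi> (y + p)) \<longleftrightarrow> (\<forall>i<m. f i x = f i y)" if "x \<in> V" "y \<in> V" for x y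
    using car(1)[OF that(1)] car(1)[OF that(2)] f[OF _ that(1)] f[OF _ that(2)] by (auto simp: vec_eq_iff)
  have inj: "x = y" if "x \<in> V" "y \<in> V" "\<forall>i<m. f i x = f i y" "g x = g y" for x y
  proof -
    have "\<phi> (x + p) = \<phi> (y + p)"
      using that fst_eq snd_eq by (simp add: prod_eq_iff)
    then have "x + p = y + p"
      using that bij by (auto simp: bij_betw_def dest: inj_onD)
    then show ?thesis by simp
  qed
  have surj: "\<exists>x\<in>V. (\<forall>i<m. f i x = u i) \<and> g x = c" for u c
  proof -
    have "(vec m u, vec 1 (\<lambda>_. c + c0)) \<in> \<phi> ` ?W"
      using bij by (auto simp: bij_betw_def)
    then obtain x where x: "x \<in> V" "\<phi> (x + p) = (vec m u, vec 1 (\<lambda>_. c + c0))"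
      by (metis (no_types, lifting) imageE)
    then show ?thesis
      using f g by (intro bexI[of _ x]) auto
  qed
  have Hg: "H = {x \<in> V. g x = 0}"
  proof
    show "H \<subseteq> {x \<in> V. g x = 0}"
    proof
      fix h assume "h \<in> H"
      then obtain x y where xy: "x \<in> V" "y \<in> V" "h = (x + p) - (y + p)" "snd (\<phi> (x + p)) = snd (\<phi> (y + p))"
        using H by blast
      then show "h \<in> {x \<in> V. g x = 0}"
        using snd_eq V by (simp add: subspace_diff linear_diff[OF glin])
    qed
    show "{x \<in> V. g x = 0} \<subseteq> H"
    proof
      fix x assume x: "x \<in> {x \<in> V. g x = 0}"
      then have "snd (\<phi> (x + p)) = snd (\<phi> (0 + p))"
        using snd_eq[of x 0] V by (simp add: subspace_0 linear_0[OF glin])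
      moreover have "x = (x + p) - (0 + p)" "x + p \<in> ?W" "0 + p \<in> ?W"
        using x subspace_0[OF V] by auto
      ultimately show "x \<in> H" unfolding H by blast
    qed
  qed
  have orbit: "y + p \<in> K" if x: "x \<in> V" and y: "y \<in> V"
    and eq: "(\<Sum>i<m. f i x * f i x) = (\<Sum>i<m. f i y * f i y)" and gxy: "g x = g y" and K: "x + p \<in> K" for x y
  proof -
    have norm: "scalar_prod (fst (\<phi> (z + p))) (fst (\<phi> (z + p))) = (\<Sum>i<m. f i z * f i z)" if "z \<in> V" for z
      using car(1)[OF that] f[OF _ that] by (auto simp: scalar_prod_def atLeast0LessThan)
    obtain Q where Q: "Q \<in> orthogonal_group m" "Q *\<^sub>v fst (\<phi> (x + p)) = fst (\<phi> (y + p))"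
      using orthogonal_group_transitive_on_spheres[OF car(1)[OF x] car(1)[OF y]] norm[OF x] norm[OF y] eq by auto
    define r where "r = restrict (the_inv_into ?W \<phi> \<circ> rotate_fst Q \<circ> \<phi>) ?W"
    have "rotate_fst Q (\<phi> (x + p)) = \<phi> (y + p)"
      using Q snd_eq[OF x y] gxy by (simp add: rotate_fst_def case_prod_beta prod_eq_iff)
    then have "r (x + p) = y + p"
      using x y bij by (simp add: r_def bij_betw_def the_inv_into_f_f)
    moreover have "r ` (K \<inter> ?W) = K \<inter> ?W"
      using inv G Q(1) unfolding invariant_under_def r_def by blast
    ultimately show ?thesis
      using x K by (metis IntI IntD1 image_eqI)
  qed
  show ?thesis
    using that[of f g, OF flin glin _ surj Hg orbit] inj[OF _ subspace_0[OF V]] flin glin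
    by (simp add: linear_0)
qed

text \<open>B x x is the squared distance of x from the axis in the coordinates above, and a is a point of the axis, so
that adding s a changes only the position along the axis.\<close>

lemma section_of_revolution:
  fixes V :: "'a::euclidean_space set"
  assumes V: "subspace V" and dV: "dim V = Suc m"
    and rev: "affine_revolution_group 1 ((\<lambda>x. x + p) ` V) G A H" and pA: "p \<in> A"
    and inv: "invariant_under G (K \<inter> (\<lambda>x. x + p) ` V)"
  obtains a and B :: "'a \<Rightarrow> 'a \<Rightarrow> real" where "a \<in> V" "a \<notin> H" "bilinear B" "\<And>x y. B x y = B y x"
    "\<And>x. x \<in> H \<Longrightarrow> x \<noteq> 0 \<Longrightarrow> B x x > 0"
    "\<And>s x y. x \<in> H \<Longrightarrow> y \<in> H \<Longrightarrow> B x x = B y y \<Longrightarrow> s *\<^sub>R a + x + p \<in> K \<Longrightarrow> s *\<^sub>R a + y + p \<in> K"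
proof -
  obtain f :: "nat \<Rightarrow> 'a \<Rightarrow> real" and g :: "'a \<Rightarrow> real"
    where flin: "\<And>i. i < m \<Longrightarrow> linear (f i)" and glin: "linear g"
    and inj: "\<And>x. x \<in> V \<Longrightarrow> \<forall>i<m. f i x = 0 \<Longrightarrow> g x = 0 \<Longrightarrow> x = 0"
    and surj: "\<And>u c. \<exists>x\<in>V. (\<forall>i<m. f i x = u i) \<and> g x = c"
    and H: "H = {x \<in> V. g x = 0}"
    and orbit: "\<And>x y. x \<in> V \<Longrightarrow> y \<in> V \<Longrightarrow> (\<Sum>i<m. f i x * f i x) = (\<Sum>i<m. f i y * f i y) \<Longrightarrow>
      g x = g y \<Longrightarrow> x + p \<in> K \<Longrightarrow> y + p \<in> K"
    using revolution_coordinates[OF assms] by blast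
  obtain a where a: "a \<in> V" "\<forall>i<m. f i a = 0" "g a = 1"
    using surj[of "\<lambda>_. 0" 1] by auto
  define B where "B x y = (\<Sum>i<m. f i x * f i y)" for x y
  have "bilinear B"
    unfolding bilinear_def B_def
    by (auto intro!: linearI simp: linear_add[OF flin] linear_scale[OF flin] sum.distrib
        sum_distrib_left algebra_simps)
  moreover have "B x y = B y x" for x y
    by (simp add: B_def mult.commute)
  moreover have "B x x > 0" if "x \<in> H" "x \<noteq> 0" for x
  proof -
    have "\<exists>i<m. f i x \<noteq> 0" using inj[of x] that H by blast
    then show ?thesis
      unfolding B_def by (auto intro!: sum_pos2 simp: zero_less_mult_iff)
  qed
  moreover have "s *\<^sub>R a + y + p \<in> K"
    if xy: "x \<in> H" "y \<in> H" "B x x = B y y" and K: "s *\<^sub>R a + x + p \<in> K" for s x y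
  proof (rule orbit[OF _ _ _ _ K])
    show "s *\<^sub>R a + x \<in> V" "s *\<^sub>R a + y \<in> V"
      using a xy V H by (auto intro: subspace_add subspace_scale)
    have "f i (s *\<^sub>R a + z) = f i z" if "i < m" for i z
      using a that by (simp add: linear_add[OF flin] linear_scale[OF flin])
    then show "(\<Sum>i<m. f i (s *\<^sub>R a + x) * f i (s *\<^sub>R a + x)) = (\<Sum>i<m. f i (s *\<^sub>R a + y) * f i (s *\<^sub>R a + y))"
      using xy by (simp add: B_def)
    show "g (s *\<^sub>R a + x) = g (s *\<^sub>R a + y)"
      using xy H by (simp add: linear_add[OF glin])
  qed
  moreover have "a \<notin> H" using a H by simp
  ultimately show ?thesis using that a by blast
qed

text \<open>Membership in K of a point of H depends only on its B-length, so a single ray decides it; on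
that ray K is a segment, whose length gives the radius.\<close>

lemma section_ellipsoid:
  fixes H :: "'a::euclidean_space set" and B :: "'a \<Rightarrow> 'a \<Rightarrow> real"
  assumes H: "subspace H" and z: "z \<in> H" "z \<noteq> 0"
    and B: "bilinear B" and pos: "\<And>x. x \<in> H \<Longrightarrow> x \<noteq> 0 \<Longrightarrow> B x x > 0"
    and inv: "\<And>x y. x \<in> H \<Longrightarrow> y \<in> H \<Longrightarrow> B x x = B y y \<Longrightarrow> x \<in> K \<Longrightarrow> y \<in> K"
    and K: "compact K" "convex K" "0 \<in> interior K"
  shows "\<exists>r>0. \<forall>x\<in>H. x \<in> K \<longleftrightarrow> B x x \<le> r"
proof -
  define z1 where "z1 = (1 / sqrt (B z z)) *\<^sub>R z"
  have z1: "z1 \<in> H" "B z1 z1 = 1"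
    using pos[OF z] z H by (auto simp: z1_def bilinear_lmul[OF B] bilinear_rmul[OF B] subspace_scale)
  have z1nz: "z1 \<noteq> 0" using z1(2) bilinear_lzero[OF B] by auto
  have zt: "B (t *\<^sub>R z1) (t *\<^sub>R z1) = t\<^sup>2" for t
    using z1 by (simp add: bilinear_lmul[OF B] bilinear_rmul[OF B] power2_eq_square)
  obtain e where e: "e > 0" "ball 0 e \<subseteq> K"
    using K(3) mem_interior by blast
  define I where "I = {t. t *\<^sub>R z1 \<in> K}"
  have "closed I"
    unfolding I_def
    using continuous_closed_vimage[of K "\<lambda>t. t *\<^sub>R z1"] compact_imp_closed[OF K(1)]
    by (auto simp: vimage_def intro!: continuous_intros)
  moreover obtain M where M: "\<And>x. x \<in> K \<Longrightarrow> norm x \<le> M"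
    using compact_imp_bounded[OF K(1)] bounded_iff by blast
  have bdI: "\<bar>t\<bar> \<le> M / norm z1" if "t \<in> I" for t
    using M[of "t *\<^sub>R z1"] that z1nz by (simp add: I_def field_simps)
  then have "bdd_above I" by (intro bdd_aboveI[of _ "M / norm z1"]) force
  moreover have small: "e / (2 * norm z1) \<in> I"
    using e z1nz by (auto simp: I_def intro!: subsetD[OF e(2)])
  ultimately have SI: "Sup I \<in> I"
    using closed_contains_Sup[of I] by blast
  have up: "t \<le> Sup I" if "t \<in> I" for t
    using cSup_upper[OF that \<open>bdd_above I\<close>] .
  have Spos: "Sup I > 0"
    using up[OF small] e z1nz by (smt (verit) divide_pos_pos zero_less_norm_iff)
  have I: "t \<in> I \<longleftrightarrow> t \<le> Sup I" if "t \<ge> 0" for t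
  proof
    assume t: "t \<le> Sup I"
    have "0 \<in> K" using K(3) interior_subset by blast
    then have "(1 - t / Sup I) *\<^sub>R 0 + (t / Sup I) *\<^sub>R (Sup I *\<^sub>R z1) \<in> K"
      using SI t that Spos by (intro convexD_alt[OF K(2)]) (auto simp: I_def)
    then show "t \<in> I" using Spos by (simp add: I_def)
  qed (use up in auto)
  show ?thesis
  proof (intro exI[of _ "(Sup I)\<^sup>2"] conjI ballI)
    show "(Sup I)\<^sup>2 > 0" using Spos by simp
    fix x assume x: "x \<in> H"
    have Bx: "B x x \<ge> 0"
      using pos[OF x] bilinear_lzero[OF B] by (cases "x = 0") auto
    define t where "t = sqrt (B x x)"
    have t: "t \<ge> 0" "t\<^sup>2 = B x x" using Bx by (auto simp: t_def)
    have "x \<in> K \<longleftrightarrow> t *\<^sub>R z1 \<in> K"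
      using inv[of x "t *\<^sub>R z1"] inv[of "t *\<^sub>R z1" x] x z1 H zt t by (auto simp: subspace_scale)
    also have "\<dots> \<longleftrightarrow> t \<le> Sup I" using I[OF t(1)] by (simp add: I_def)
    also have "\<dots> \<longleftrightarrow> t\<^sup>2 \<le> (Sup I)\<^sup>2"
      using power_mono_iff[of t "Sup I" 2] t(1) Spos by simp
    finally show "x \<in> K \<longleftrightarrow> B x x \<le> (Sup I)\<^sup>2" using t by simp
  qed
qed

lemma translated_to_origin:
  fixes K :: "'a::euclidean_space set"
  assumes "compact K" "convex K" "p \<in> interior K"
  shows "compact {x. x + p \<in> K}" "convex {x. x + p \<in> K}" "0 \<in> interior {x. x + p \<in> K}"
proof -
  have eq: "{x. x + p \<in> S} = (+) (- p) ` S" for S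
  proof
    show "{x. x + p \<in> S} \<subseteq> (+) (- p) ` S"
    proof
      fix x assume "x \<in> {x. x + p \<in> S}"
      then show "x \<in> (+) (- p) ` S" by (intro image_eqI[of _ _ "x + p"]) auto
    qed
  qed auto
  show "compact {x. x + p \<in> K}" "convex {x. x + p \<in> K}"
    unfolding eq by (rule compact_translation[OF assms(1)], rule convex_translation[OF assms(2)])
  have "0 \<in> {x. x + p \<in> interior K}" using assms(3) by simp
  then show "0 \<in> interior {x. x + p \<in> K}"
    unfolding eq interior_translation .
qed

text \<open>The part of the hypothesis on one section that the gluing uses, with the vector a on the axis
scaled to level 1 and the form B scaled so that K \<inter> H, seen from p, is its unit ball.\<close>

definition revolved_about ::
    "'a::euclidean_space set \<Rightarrow> 'a \<Rightarrow> 'a \<Rightarrow> 'a set \<Rightarrow> 'a set \<Rightarrow> 'a \<Rightarrow> ('a \<Rightarrow> 'a \<Rightarrow> real) \<Rightarrow> bool"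
  where "revolved_about K p t V H a B \<longleftrightarrow> a \<in> V \<and> a \<bullet> t = 1 \<and> bilinear B \<and> (\<forall>x y. B x y = B y x) \<and>
    (\<forall>x\<in>H. x \<noteq> 0 \<longrightarrow> B x x > 0) \<and> (\<forall>x\<in>H. x + p \<in> K \<longleftrightarrow> B x x \<le> 1) \<and>
    (\<forall>s. \<forall>x\<in>H. \<forall>y\<in>H. B x x = B y y \<longrightarrow> s *\<^sub>R a + x + p \<in> K \<longrightarrow> s *\<^sub>R a + y + p \<in> K)"

lemma normalized_section:
  fixes V :: "'a::euclidean_space set"
  assumes V: "subspace V" and dV: "dim V = Suc m" and m: "m \<ge> 1"
    and H: "subspace H" "dim H = m" and VT: "V \<inter> {x. x \<bullet> t = 0} = H"
    and K: "compact K" "convex K" "p \<in> interior K"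
    and rev: "affine_revolution_group 1 ((\<lambda>x. x + p) ` V) G A H" and pA: "p \<in> A"
    and inv: "invariant_under G (K \<inter> (\<lambda>x. x + p) ` V)"
  shows "\<exists>a B. revolved_about K p t V H a B"
proof -
  obtain a and B :: "'a \<Rightarrow> 'a \<Rightarrow> real" where a: "a \<in> V" "a \<notin> H" and B: "bilinear B" "\<And>x y. B x y = B y x"
    and pos: "\<And>x. x \<in> H \<Longrightarrow> x \<noteq> 0 \<Longrightarrow> B x x > 0"
    and orbit: "\<And>s x y. x \<in> H \<Longrightarrow> y \<in> H \<Longrightarrow> B x x = B y y \<Longrightarrow> s *\<^sub>R a + x + p \<in> K \<Longrightarrow> s *\<^sub>R a + y + p \<in> K"
    using section_of_revolution[OF V dV rev pA inv] by metis
  have "H \<noteq> {0}" using H m by auto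
  then obtain z where z: "z \<in> H" "z \<noteq> 0"
    using H subspace_0 by blast
  have inv: "y \<in> {x. x + p \<in> K}" if "x \<in> H" "y \<in> H" "B x x = B y y" "x \<in> {x. x + p \<in> K}" for x y
    using orbit[OF that(1-3), of 0] that(4) by simp
  have "\<exists>r>0. \<forall>x\<in>H. x \<in> {x. x + p \<in> K} \<longleftrightarrow> B x x \<le> r"
    using H(1) z B(1) pos inv translated_to_origin[OF K] by (rule section_ellipsoid)
  then obtain r where r: "r > 0" "\<And>x. x \<in> H \<Longrightarrow> x + p \<in> K \<longleftrightarrow> B x x \<le> r"
    by blast
  have at: "a \<bullet> t \<noteq> 0" using a VT by auto
  have "revolved_about K p t V H ((1 / (a \<bullet> t)) *\<^sub>R a) (\<lambda>x y. B x y / r)"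
    unfolding revolved_about_def
  proof (intro conjI allI ballI impI)
    show "bilinear (\<lambda>x y. B x y / r)"
      unfolding bilinear_def
      by (auto intro!: linearI simp: bilinear_ladd[OF B(1)] bilinear_radd[OF B(1)]
          bilinear_lmul[OF B(1)] bilinear_rmul[OF B(1)] add_divide_distrib)
    show "s *\<^sub>R (1 / (a \<bullet> t)) *\<^sub>R a + y + p \<in> K"
      if "x \<in> H" "y \<in> H" "B x x / r = B y y / r" "s *\<^sub>R (1 / (a \<bullet> t)) *\<^sub>R a + x + p \<in> K" for s x y
      using orbit[of x y "s * (1 / (a \<bullet> t))"] that r by simp
    show "B x y / r = B y x / r" for x y
      using B(2)[of x y] by simp
  qed (use a at V pos r in \<open>auto simp: subspace_scale\<close>)
  then show ?thesis by blast
qed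

section \<open>Gluing the sections\<close>

text \<open>On a common vector of two hyperplanes the forms agree because both are determined by which
multiples of the vector lie in K. So x \<mapsto> B H x x, for any H containing x, is one function on T,
quadratic on planes.\<close>

lemma ellipsoid_from_sections:
  fixes T :: "'a::euclidean_space set" and B :: "'a set \<Rightarrow> 'a \<Rightarrow> 'a \<Rightarrow> real"
  assumes T: "subspace T" and dT: "dim T = Suc k" and k: "k \<ge> 2"
    and B: "\<And>H. H \<in> Gr k T \<Longrightarrow> bilinear (B H)"
    and sym: "\<And>H x y. H \<in> Gr k T \<Longrightarrow> B H x y = B H y x"
    and pos: "\<And>H x. H \<in> Gr k T \<Longrightarrow> x \<in> H \<Longrightarrow> x \<noteq> 0 \<Longrightarrow> B H x x > 0"
    and trace: "\<And>H x. H \<in> Gr k T \<Longrightarrow> x \<in> H \<Longrightarrow> x \<in> K \<longleftrightarrow> B H x x \<le> 1"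
  shows "\<exists>D :: 'a \<Rightarrow> 'a \<Rightarrow> real. bilinear D \<and> (\<forall>x y. D x y = D y x) \<and>
    (\<forall>H\<in>Gr k T. \<forall>x\<in>H. \<forall>y\<in>H. B H x y = D x y)"
proof -
  have sub: "subspace H" "H \<subseteq> T" if "H \<in> Gr k T" for H
    using that by (auto simp: Gr_def)
  have le: "B H x x \<ge> B H' x x" if H: "H \<in> Gr k T" "H' \<in> Gr k T" and x: "x \<in> H" "x \<in> H'" for H H' x
  proof (rule ccontr)
    assume "\<not> B H x x \<ge> B H' x x"
    then have less: "B H x x < B H' x x" by simp
    have nonneg: "B H x x \<ge> 0"
      using pos[OF H(1) x(1)] bilinear_lzero[OF B[OF H(1)]] by (cases "x = 0") auto
    \<comment> \<open>c x lies in K as seen from H but not as seen from H'.\<close>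
    define c where "c = sqrt (2 / (B H x x + B H' x x))"
    have c: "c * c = 2 / (B H x x + B H' x x)"
      using less nonneg by (simp add: c_def)
    have cx: "c *\<^sub>R x \<in> H" "c *\<^sub>R x \<in> H'"
      using x sub H by (auto simp: subspace_scale)
    have s: "B H (c *\<^sub>R x) (c *\<^sub>R x) = c * c * B H x x" "B H' (c *\<^sub>R x) (c *\<^sub>R x) = c * c * B H' x x"
      using H by (simp_all add: bilinear_lmul[OF B] bilinear_rmul[OF B])
    have "c * c * B H x x \<le> 1" "c * c * B H' x x > 1"
      using less nonneg unfolding c by (simp_all add: field_simps)
    then show False
      using trace[OF H(1) cx(1)] trace[OF H(2) cx(2)] s by simp
  qed
  then have agree: "B H x x = B H' x x"
    if "H \<in> Gr k T" "H' \<in> Gr k T" "x \<in> H" "x \<in> H'" for H H' x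
    using that by (meson order_antisym)
  let ?P = "closest_point T"
  note P = linear_closest_point[OF T]
  note PT = closest_point_in_subspace[OF T]
  define q where "q x = B (SOME H. H \<in> Gr k T \<and> ?P x \<in> H) (?P x) (?P x)" for x
  have q: "q x = B H (?P x) (?P x)" if "H \<in> Gr k T" "?P x \<in> H" for H x
  proof -
    have "(SOME H. H \<in> Gr k T \<and> ?P x \<in> H) \<in> Gr k T \<and> ?P x \<in> (SOME H. H \<in> Gr k T \<and> ?P x \<in> H)"
      by (rule someI[of "\<lambda>H. H \<in> Gr k T \<and> ?P x \<in> H", OF conjI[OF that]])
    then show ?thesis
      unfolding q_def by (intro agree that) blast+
  qed
  have "\<exists>\<beta>. \<forall>s t. q (s *\<^sub>R x + t *\<^sub>R y) = s\<^sup>2 * q x + 2 * s * t * \<beta> + t\<^sup>2 * q y" for x y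
  proof -
    obtain H where H: "H \<in> Gr k T" "?P x \<in> H" "?P y \<in> H"
      using pair_in_hyperplane[OF T dT k PT PT] by metis
    have comb: "?P (s *\<^sub>R x + t *\<^sub>R y) = s *\<^sub>R ?P x + t *\<^sub>R ?P y" for s t
      by (simp add: linear_add[OF P] linear_scale[OF P])
    have "q (s *\<^sub>R x + t *\<^sub>R y) = s\<^sup>2 * q x + 2 * s * t * B H (?P x) (?P y) + t\<^sup>2 * q y" for s t
    proof -
      have "?P (s *\<^sub>R x + t *\<^sub>R y) \<in> H"
        using H sub unfolding comb by (auto intro: subspace_add subspace_scale)
      then have "q (s *\<^sub>R x + t *\<^sub>R y) = B H (s *\<^sub>R ?P x + t *\<^sub>R ?P y) (s *\<^sub>R ?P x + t *\<^sub>R ?P y)"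
        using q[OF H(1)] comb by simp
      also have "\<dots> = s\<^sup>2 * q x + 2 * s * t * B H (?P x) (?P y) + t\<^sup>2 * q y"
        unfolding q[OF H(1,2)] q[OF H(1,3)]
        by (rule bilinear_quadratic_expand[OF B[OF H(1)] sym[OF H(1)]])
      finally show ?thesis .
    qed
    then show ?thesis by blast
  qed
  then obtain D where D: "bilinear D" "\<And>x y. D x y = D y x" "\<And>x. D x x = q x"
    using jordan_von_neumann[of q] by blast
  have diag: "B H x x = D x x" if "H \<in> Gr k T" "x \<in> H" for H x
  proof -
    have "?P x = x" using sub that by (auto intro: closest_point_self)
    then show ?thesis using q[of H x] that D(3) by simp
  qed
  have "B H x y = D x y" if H: "H \<in> Gr k T" and xy: "x \<in> H" "y \<in> H" for H x y
  proof -
    have "B H (x + y) (x + y) = D (x + y) (x + y)"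
      using diag[OF H] sub[OF H] xy by (simp add: subspace_add)
    then show ?thesis
      using diag[OF H xy(1)] diag[OF H xy(2)] sym[OF H, of y x] D(2)[of y x]
      by (simp add: bilinear_ladd[OF B[OF H]] bilinear_radd[OF B[OF H]]
          bilinear_ladd[OF D(1)] bilinear_radd[OF D(1)])
  qed
  then show ?thesis using D(1,2) by blast
qed

text \<open>The situation after translating p to the origin and merging the forms of the sections into one
form D.\<close>

locale revolved_sections =
  fixes K T :: "'a::euclidean_space set" and t :: 'a and k :: nat
    and \<sigma> :: "'a set \<Rightarrow> 'a set" and a :: "'a set \<Rightarrow> 'a" and D :: "'a \<Rightarrow> 'a \<Rightarrow> real"
  assumes K_bounded: "bounded K" and K_0: "0 \<in> interior K"
    and k: "k \<ge> 2" and dim_space: "DIM('a) = k + 2"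
    and t: "norm t = 1" and T_eq: "T = {x. x \<bullet> t = 0}"
    and \<sigma>_Gr: "H \<in> Gr k T \<Longrightarrow> \<sigma> H \<in> Gr (Suc k) UNIV"
    and \<sigma>_T: "H \<in> Gr k T \<Longrightarrow> \<sigma> H \<inter> T = H"
    and \<sigma>_cont: "continuous_map (grassmannian k T) (grassmannian (Suc k) UNIV) \<sigma>"
    and a_\<sigma>: "H \<in> Gr k T \<Longrightarrow> a H \<in> \<sigma> H"
    and a_t: "H \<in> Gr k T \<Longrightarrow> a H \<bullet> t = 1"
    and D: "bilinear D" and D_sym: "D x y = D y x"
    and D_pos: "x \<in> T \<Longrightarrow> x \<noteq> 0 \<Longrightarrow> D x x > 0"
    and orbit: "H \<in> Gr k T \<Longrightarrow> x \<in> H \<Longrightarrow> y \<in> H \<Longrightarrow> D x x = D y y \<Longrightarrow>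
      s *\<^sub>R a H + x \<in> K \<Longrightarrow> s *\<^sub>R a H + y \<in> K"
begin

lemmas D_simps = bilinear_ladd[OF D] bilinear_radd[OF D] bilinear_lsub[OF D] bilinear_rsub[OF D]
  bilinear_lmul[OF D] bilinear_rmul[OF D] bilinear_lzero[OF D] bilinear_rzero[OF D]

lemma t_t: "t \<bullet> t = 1"
  using t by (simp add: norm_eq_1)

lemma T: "subspace T"
  unfolding T_eq by (auto simp: subspace_def inner_add_left)

lemma dim_T: "dim T = Suc k"
  using hyperplane_in_Gr[of UNIV "Suc k" t] dim_space t_t unfolding T_eq
  by (cases "t = 0") (auto simp: Gr_def)

lemma Gr_D: "H \<in> Gr k T \<Longrightarrow> subspace H" "H \<in> Gr k T \<Longrightarrow> H \<subseteq> T" "H \<in> Gr k T \<Longrightarrow> dim H = k"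
  by (auto simp: Gr_def)

lemma \<sigma>_D: "H \<in> Gr k T \<Longrightarrow> subspace (\<sigma> H)" "H \<in> Gr k T \<Longrightarrow> dim (\<sigma> H) = Suc k"
  using \<sigma>_Gr by (auto simp: Gr_def)

lemma hyperplane_containing:
  assumes "x \<in> T" "y \<in> T"
  obtains H where "H \<in> Gr k T" "x \<in> H" "y \<in> H"
  using pair_in_hyperplane[OF T dim_T k assms] .

text \<open>Two hyperplanes of the ambient space meet in codimension at most 2. If the intersection had only
vectors of level 0, it would lie in H \<inter> H', which has codimension 3 unless H = H'.\<close>

lemma level_one_common:
  assumes H: "H \<in> Gr k T" and H': "H' \<in> Gr k T"
  obtains b where "b \<in> \<sigma> H" "b \<in> \<sigma> H'" "b \<bullet> t = 1"
proof (cases "\<sigma> H \<inter> \<sigma> H' \<subseteq> T")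
  case True
  then have sub: "\<sigma> H \<inter> \<sigma> H' \<subseteq> H" "\<sigma> H \<inter> \<sigma> H' \<subseteq> H'"
    using \<sigma>_T[OF H] \<sigma>_T[OF H'] by auto
  have "dim {x + y |x y. x \<in> \<sigma> H \<and> y \<in> \<sigma> H'} + dim (\<sigma> H \<inter> \<sigma> H') = Suc k + Suc k"
    using dim_sums_Int[of "\<sigma> H" "\<sigma> H'"] \<sigma>_D[OF H] \<sigma>_D[OF H'] by simp
  moreover have "dim {x + y |x y. x \<in> \<sigma> H \<and> y \<in> \<sigma> H'} \<le> k + 2"
    using dim_subset_UNIV[of "{x + y |x y. x \<in> \<sigma> H \<and> y \<in> \<sigma> H'}"] dim_space by simp
  ultimately have "dim (\<sigma> H \<inter> \<sigma> H') \<ge> k" by simp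
  then have "\<sigma> H \<inter> \<sigma> H' = H" "\<sigma> H \<inter> \<sigma> H' = H'"
    using subspace_dim_equal[OF _ _ sub(1)] subspace_dim_equal[OF _ _ sub(2)]
      \<sigma>_D[OF H] \<sigma>_D[OF H'] Gr_D[OF H] Gr_D[OF H'] by (auto simp: subspace_inter)
  then have "H = H'" by simp
  then show ?thesis using that a_\<sigma>[OF H] a_t[OF H] by blast
next
  case False
  then obtain b where b: "b \<in> \<sigma> H" "b \<in> \<sigma> H'" "b \<bullet> t \<noteq> 0"
    by (auto simp: T_eq)
  then show ?thesis
    using that[of "(1 / (b \<bullet> t)) *\<^sub>R b"] \<sigma>_D[OF H] \<sigma>_D[OF H'] by (simp add: subspace_scale)
qed

text \<open>On the line s b + \<real>h, the group of each section induces the reflection \<tau> \<mapsto> c - \<tau> of the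
parameter \<tau>, with c determined by the D-component along h of the vector from the axis to s b. If the two
values of c differed, composing the reflections would translate the part of the line in K to
itself by a nonzero amount, and K would be unbounded.\<close>

lemma axes_agree:
  assumes H: "H \<in> Gr k T" and H': "H' \<in> Gr k T" and h: "h \<in> H" "h \<in> H'"
  shows "D (a H) h = D (a H') h"
proof (cases "h = 0")
  case True
  then show ?thesis by (simp add: D_simps)
next
  case False
  obtain b where b: "b \<in> \<sigma> H" "b \<in> \<sigma> H'" "b \<bullet> t = 1"
    using level_one_common[OF H H'] .
  have hh: "D h h > 0"
    using D_pos[OF _ False] h Gr_D(2)[OF H] by blast
  obtain e where e: "e > 0" "ball 0 e \<subseteq> K"
    using K_0 mem_interior by blast
  have "b \<noteq> 0" using b by auto
  define s where "s = e / (2 * norm b)"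
  have s: "s > 0" using e \<open>b \<noteq> 0\<close> by (simp add: s_def)
  have sb: "s *\<^sub>R b \<in> K"
    using e \<open>b \<noteq> 0\<close> by (intro subsetD[OF e(2)]) (simp add: s_def)
  \<comment> \<open>Twice the parameter of the D-orthogonal projection of the axis point s a(G) to the line s b + \<real>h.\<close>
  define c where "c G = - 2 * D (s *\<^sub>R (b - a G)) h / D h h" for G
  have refl: "s *\<^sub>R b + (c G - \<tau>) *\<^sub>R h \<in> K"
    if G: "G \<in> Gr k T" "b \<in> \<sigma> G" "h \<in> G" and K: "s *\<^sub>R b + \<tau> *\<^sub>R h \<in> K" for G \<tau>
  proof -
    have "b - a G \<in> \<sigma> G \<inter> T"
      using G a_\<sigma>[OF G(1)] a_t[OF G(1)] \<sigma>_D[OF G(1)] b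
      by (auto simp: T_eq inner_diff_left subspace_diff)
    then have "b - a G \<in> G" using \<sigma>_T[OF G(1)] by simp
    then have mem: "s *\<^sub>R (b - a G) + r *\<^sub>R h \<in> G" for r
      using G Gr_D(1)[OF G(1)] by (auto intro: subspace_add subspace_scale)
    have split: "s *\<^sub>R b + r *\<^sub>R h = s *\<^sub>R a G + (s *\<^sub>R (b - a G) + r *\<^sub>R h)" for r
      by (simp add: algebra_simps)
    have "D (u + \<tau> *\<^sub>R h) (u + \<tau> *\<^sub>R h) = D (u + (r - \<tau>) *\<^sub>R h) (u + (r - \<tau>) *\<^sub>R h)"
      if "r * D h h = - 2 * D u h" for u r
    proof -
      have "D (u + (r - \<tau>) *\<^sub>R h) (u + (r - \<tau>) *\<^sub>R h) - D (u + \<tau> *\<^sub>R h) (u + \<tau> *\<^sub>R h)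
        = (r - 2 * \<tau>) * (2 * D u h + r * D h h)"
        using D_sym[of h u] by (simp add: D_simps algebra_simps)
      then show ?thesis using that by simp
    qed
    moreover have "c G * D h h = - 2 * D (s *\<^sub>R (b - a G)) h"
      using hh by (simp add: c_def)
    ultimately show ?thesis
      using orbit[OF G(1) mem mem] K unfolding split by blast
  qed
  have transl: "s *\<^sub>R b + (real j * (c H' - c H)) *\<^sub>R h \<in> K" for j
  proof (induction j)
    case (Suc j)
    have "c H' - (c H - real j * (c H' - c H)) = real (Suc j) * (c H' - c H)"
      by (simp add: algebra_simps)
    then show ?case
      using refl[OF H' b(2) h(2) refl[OF H b(1) h(1) Suc]] by simp
  qed (use sb in simp)
  have "c H' - c H = 0"
  proof (rule ccontr)
    assume nz: "c H' - c H \<noteq> 0"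
    obtain M where M: "\<And>x. x \<in> K \<Longrightarrow> norm x \<le> M"
      using K_bounded bounded_iff by blast
    define \<delta> where "\<delta> = \<bar>c H' - c H\<bar> * norm h"
    have "\<delta> > 0" using nz False by (simp add: \<delta>_def)
    then obtain j :: nat where j: "real j * \<delta> > M + norm (s *\<^sub>R b)"
      using reals_Archimedean3 by blast
    have "real j * \<delta> = norm ((real j * (c H' - c H)) *\<^sub>R h)"
      by (simp add: \<delta>_def abs_mult)
    also have "\<dots> \<le> norm (s *\<^sub>R b + (real j * (c H' - c H)) *\<^sub>R h) + norm (s *\<^sub>R b)"
      by (metis add.commute add_diff_cancel_left' norm_triangle_ineq4)
    finally show False using M[OF transl[of j]] j by simp
  qed
  then show ?thesis
    using hh s by (simp add: c_def D_simps field_simps)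
qed

text \<open>Concurrency of the axes modulo H. The points a(H) are not determined by c: each may differ from it
by a vector D-orthogonal to H. That vector is harmless, as it is fixed by the rotations of H.\<close>

lemma common_axis:
  obtains c where "c \<bullet> t = 1" "\<And>H h. H \<in> Gr k T \<Longrightarrow> h \<in> H \<Longrightarrow> D (a H) h = D c h"
proof -
  let ?P = "closest_point T"
  note P = linear_closest_point[OF T]
  note PT = closest_point_in_subspace[OF T]
  have Pid: "?P x = x" if "x \<in> T" for x
    using that by (rule closest_point_self)
  \<comment> \<open>The base point t brings a(H) down to level 0, where D is an inner product; the projection
    extends the functional from T to the whole space.\<close>
  define l where "l x = D (a (SOME H. H \<in> Gr k T \<and> ?P x \<in> H) - t) (?P x)" for x
  have l: "l x = D (a H - t) (?P x)" if "H \<in> Gr k T" "?P x \<in> H" for H x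
  proof -
    have "(SOME H. H \<in> Gr k T \<and> ?P x \<in> H) \<in> Gr k T \<and> ?P x \<in> (SOME H. H \<in> Gr k T \<and> ?P x \<in> H)"
      by (rule someI[of "\<lambda>H. H \<in> Gr k T \<and> ?P x \<in> H", OF conjI[OF that]])
    then show ?thesis
      unfolding l_def bilinear_lsub[OF D] by (intro arg_cong2[of _ _ _ _ "(-)"] axes_agree that refl) blast+
  qed
  have lin: "linear l"
  proof (rule linearI)
    fix x y :: 'a and r :: real
    obtain H where H: "H \<in> Gr k T" "?P x \<in> H" "?P y \<in> H"
      using hyperplane_containing[OF PT PT] by metis
    have "?P (x + y) \<in> H" "?P (r *\<^sub>R x) \<in> H"
      using H Gr_D(1)[OF H(1)] by (auto simp: linear_add[OF P] linear_scale[OF P] subspace_add subspace_scale)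
    then show "l (x + y) = l x + l y" "l (r *\<^sub>R x) = r *\<^sub>R l x"
      using l[OF H(1)] H by (simp_all add: linear_add[OF P] linear_scale[OF P] D_simps right_diff_distrib)
  qed
  obtain e where e: "\<And>i. i < Suc k \<Longrightarrow> e i \<in> T"
    "\<And>i j. i < Suc k \<Longrightarrow> j < Suc k \<Longrightarrow> D (e i) (e j) = (if i = j then 1 else 0)"
    "\<And>x. x \<in> T \<Longrightarrow> x = (\<Sum>i<Suc k. D (e i) x *\<^sub>R e i)"
    using gram_schmidt[OF T dim_T D D_sym D_pos] by blast
  \<comment> \<open>The Riesz vector of l, moved to level 1. The unit normal t serves as origin of that level.\<close>
  define c where "c = t + (\<Sum>i<Suc k. l (e i) *\<^sub>R e i)"
  have "(\<Sum>i<Suc k. l (e i) *\<^sub>R e i) \<in> T"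
    using e(1) T by (intro subspace_sum subspace_scale) auto
  then have "c \<bullet> t = 1"
    using t_t by (simp add: c_def T_eq inner_add_left)
  moreover have "D (a H) h = D c h" if H: "H \<in> Gr k T" "h \<in> H" for H h
  proof -
    have hT: "h \<in> T" using H Gr_D(2) by blast
    have "D (a H - t) h = l h"
      using l[OF H(1), of h] H Pid[OF hT] by simp
    also have "l h = l (\<Sum>i<Suc k. D (e i) h *\<^sub>R e i)"
      using e(3)[OF hT] by simp
    also have "\<dots> = (\<Sum>i<Suc k. D (e i) h * l (e i))"
      by (simp only: linear_sum[OF lin] linear_scale[OF lin] real_scaleR_def)
    also have "\<dots> = D (\<Sum>i<Suc k. l (e i) *\<^sub>R e i) h"
      unfolding bilinear_left_sum[OF D] by (intro sum.cong) simp_all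
    finally show ?thesis by (simp add: c_def D_simps)
  qed
  ultimately show ?thesis using that by blast
qed

text \<open>An intermediate value argument, the only place where the continuity of \<sigma> matters. The normal
m \<theta> of H \<theta> in T turns in a plane of T orthogonal to d, so that d \<in> H \<theta> throughout. The function
g \<theta> compares the component of x normal to \<sigma>(H \<theta>) with m \<theta>. It is insensitive to the choice of a
sign for the normal of \<sigma>(H \<theta>), hence continuous, and it changes sign after a half-turn because
H \<theta> returns to itself while m \<theta> is reversed.\<close>

lemma section_through:
  assumes d: "d \<in> T"
  obtains H where "H \<in> Gr k T" "d \<in> H" "x \<in> \<sigma> H"
proof -
  have dT: "dim T > 2" using dim_T k by simp
  obtain m1 where m1: "m1 \<in> T" "norm m1 = 1" "d \<bullet> m1 = 0"
    using unit_normal_to_pair[OF T dT d d] by blast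
  obtain m2 where m2: "m2 \<in> T" "norm m2 = 1" "d \<bullet> m2 = 0" "m1 \<bullet> m2 = 0"
    using unit_normal_to_pair[OF T dT d m1(1)] by blast
  define m where "m \<theta> = cos \<theta> *\<^sub>R m1 + sin \<theta> *\<^sub>R m2" for \<theta>
  define H where "H \<theta> = {x \<in> T. x \<bullet> m \<theta> = 0}" for \<theta>
  have mT: "m \<theta> \<in> T" for \<theta>
    using m1 m2 T by (simp add: m_def subspace_add subspace_scale)
  have mt: "m \<theta> \<bullet> t = 0" for \<theta>
    using mT[of \<theta>] by (simp add: T_eq)
  have mm: "m \<theta> \<bullet> m \<theta> = 1" for \<theta>
  proof -
    have "m \<theta> \<bullet> m \<theta> = (cos \<theta>)\<^sup>2 * (m1 \<bullet> m1) + (sin \<theta>)\<^sup>2 * (m2 \<bullet> m2) + 2 * cos \<theta> * sin \<theta> * (m1 \<bullet> m2)"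
      by (simp add: m_def inner_add_left inner_add_right inner_commute power2_eq_square)
    then show ?thesis using m1 m2 by (simp add: norm_eq_1)
  qed
  have H: "H \<theta> \<in> Gr k T" for \<theta>
    unfolding H_def using mm[of \<theta>] by (intro hyperplane_in_Gr[OF T dim_T mT]) auto
  have proj: "closest_point (H \<theta>) y = y - (y \<bullet> t) *\<^sub>R t - (y \<bullet> m \<theta>) *\<^sub>R m \<theta>" for \<theta> y
  proof (rule closest_point_subspace_eq[OF Gr_D(1)[OF H]])
    show "y - (y \<bullet> t) *\<^sub>R t - (y \<bullet> m \<theta>) *\<^sub>R m \<theta> \<in> H \<theta>"
      using mt[of \<theta>] inner_commute[of t "m \<theta>"] mm[of \<theta>] t_t
      by (simp add: H_def T_eq inner_diff_left)
    fix v assume "v \<in> H \<theta>"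
    then show "(y - (y - (y \<bullet> t) *\<^sub>R t - (y \<bullet> m \<theta>) *\<^sub>R m \<theta>)) \<bullet> v = 0"
      by (simp add: H_def T_eq inner_add_left inner_commute[of t v] inner_commute[of "m \<theta>" v])
  qed
  have m_cont: "continuous_on UNIV m"
    unfolding m_def by (intro continuous_intros)
  have blin: "blinfun_apply (Blinfun (closest_point V)) = closest_point V" if "subspace V" for V :: "'a set"
    using bounded_linear_closest_point[OF that] by (rule bounded_linear_Blinfun_apply)
  have "continuous_on UNIV (\<lambda>\<theta>. Blinfun (closest_point (H \<theta>)))"
    by (rule continuous_on_blinfun_componentwise)
      (auto simp: blin[OF Gr_D(1)[OF H]] proj intro!: continuous_intros m_cont)
  then have "continuous_map euclidean (grassmannian k T) H"
    unfolding grassmannian_def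
    by (intro continuous_map_pullback') (auto simp: o_def H)
  from continuous_map_compose[OF this \<sigma>_cont]
  have "continuous_map euclidean (grassmannian (Suc k) UNIV) (\<sigma> \<circ> H)" .
  from continuous_map_compose[OF this[unfolded grassmannian_def] continuous_map_pullback[OF continuous_map_id]]
  have "continuous_on UNIV (\<lambda>\<theta>. Blinfun (closest_point (\<sigma> (H \<theta>))))"
    by (simp add: o_def)
  then have "continuous_on UNIV (\<lambda>\<theta>. blinfun_apply (Blinfun (closest_point (\<sigma> (H \<theta>)))) x)"
    by (intro continuous_intros)
  then have P_cont: "continuous_on UNIV (\<lambda>\<theta>. closest_point (\<sigma> (H \<theta>)) x)"
    by (simp add: blin[OF \<sigma>_D(1)[OF H]])
  define g where "g \<theta> = (x - closest_point (\<sigma> (H \<theta>)) x) \<bullet> m \<theta>" for \<theta>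
  have g_cont: "continuous_on {0..pi} g"
    unfolding g_def
    by (rule continuous_on_subset[of UNIV]) (auto intro!: continuous_intros P_cont m_cont)
  have "m pi = - m 0" by (simp add: m_def)
  then have "H pi = H 0" "g pi = - g 0" by (simp_all add: H_def g_def)
  have "\<exists>\<theta>. g \<theta> = 0"
  proof (cases "g 0 \<le> 0")
    case True
    then show ?thesis
      using IVT'[OF _ _ pi_ge_zero g_cont, of 0] \<open>g pi = - g 0\<close> by auto
  next
    case False
    then show ?thesis
      using IVT2'[OF _ _ pi_ge_zero g_cont, of 0] \<open>g pi = - g 0\<close> by auto
  qed
  then obtain \<theta> where \<theta>: "g \<theta> = 0" by blast
  let ?S = "\<sigma> (H \<theta>)"
  define \<nu> where "\<nu> = x - closest_point ?S x"
  have S: "subspace ?S" "dim ?S = Suc k"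
    using \<sigma>_D[OF H] by auto
  have Px: "closest_point ?S x \<in> ?S"
    by (rule closest_point_in_subspace[OF S(1)])
  have "\<nu> = 0"
  proof (rule ccontr)
    assume nz: "\<nu> \<noteq> 0"
    \<comment> \<open>Then \<sigma>(H \<theta>) is the complement of \<nu> and contains m \<theta>, against \<sigma>(H \<theta>) \<inter> T = H \<theta>.\<close>
    have perp: "v \<bullet> \<nu> = 0" if "v \<in> ?S" for v
    proof -
      have "\<nu> \<bullet> w \<le> 0" if w: "w \<in> ?S" for w
        using closest_point_dot[OF subspace_imp_convex[OF S(1)] closed_subspace[OF S(1)]
            subspace_add[OF S(1) Px w], of x] by (simp add: \<nu>_def)
      from this[OF that] this[OF subspace_neg[OF S(1) that]] show ?thesis
        by (simp add: inner_commute)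
    qed
    have G: "{y \<in> UNIV. y \<bullet> \<nu> = 0} \<in> Gr (Suc k) UNIV"
      using nz dim_space by (intro hyperplane_in_Gr) auto
    have "?S = {y \<in> UNIV. y \<bullet> \<nu> = 0}"
      using perp S G by (intro subspace_dim_equal) (auto simp: Gr_def)
    moreover have "m \<theta> \<bullet> \<nu> = 0"
      using \<theta> by (simp add: g_def \<nu>_def inner_commute)
    ultimately have "m \<theta> \<in> ?S \<inter> T" using mT by simp
    then have "m \<theta> \<in> H \<theta>" using \<sigma>_T[OF H] by simp
    then show False using mm[of \<theta>] by (simp add: H_def)
  qed
  then have "x \<in> ?S" using Px by (simp add: \<nu>_def)
  moreover have "d \<in> H \<theta>"
    using d m1 m2 by (simp add: H_def m_def inner_add_right)
  ultimately show ?thesis using that H by blast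
qed

text \<open>For given x and y, choose a section through s c + x whose H contains x - y. It then contains
s c + y as well. Seen from the axis of that section, both points are displaced by the same vector
w = s (c - a(H)), which is D-orthogonal to x - y, so their distances from the axis stay equal.\<close>

lemma revolves_about_common_axis:
  obtains c where "c \<bullet> t = 1"
    "\<And>s x y. x \<in> T \<Longrightarrow> y \<in> T \<Longrightarrow> D x x = D y y \<Longrightarrow> s *\<^sub>R c + x \<in> K \<Longrightarrow> s *\<^sub>R c + y \<in> K"
proof -
  obtain c where c: "c \<bullet> t = 1" "\<And>H h. H \<in> Gr k T \<Longrightarrow> h \<in> H \<Longrightarrow> D (a H) h = D c h"
    using common_axis by blast
  have "s *\<^sub>R c + y \<in> K"
    if xy: "x \<in> T" "y \<in> T" "D x x = D y y" and K: "s *\<^sub>R c + x \<in> K" for s x y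
  proof -
    obtain H where H: "H \<in> Gr k T" "x - y \<in> H" "s *\<^sub>R c + x \<in> \<sigma> H"
      using section_through[of "x - y"] xy T subspace_diff by metis
    define w where "w = s *\<^sub>R (c - a H)"
    have x: "s *\<^sub>R c + x = s *\<^sub>R a H + (w + x)" and y: "s *\<^sub>R c + y = s *\<^sub>R a H + (w + y)"
      by (simp_all add: w_def algebra_simps)
    have "s *\<^sub>R c + x - s *\<^sub>R a H \<in> \<sigma> H"
      using H(3) a_\<sigma>[OF H(1)] \<sigma>_D(1)[OF H(1)] by (simp add: subspace_diff subspace_scale)
    then have "w + x \<in> \<sigma> H" unfolding x by simp
    moreover have "w + x \<in> T"
      using xy a_t[OF H(1)] c(1) by (simp add: T_eq w_def inner_add_left inner_diff_left)
    \<comment> \<open>The displacement of s c + x from the axis point s a(H) is in \<sigma>(H) and has level 0, so it is in H.\<close>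
    ultimately have wx: "w + x \<in> H" using \<sigma>_T[OF H(1)] by blast
    then have "(w + x) - (x - y) \<in> H" using H Gr_D(1) by (blast intro: subspace_diff)
    then have wy: "w + y \<in> H" by simp
    have "D w (x - y) = 0"
      using c(2)[OF H(1,2)] by (simp add: w_def D_simps)
    then have "D (w + x) (w + x) = D (w + y) (w + y)"
      using xy(3) D_sym[of x w] D_sym[of y w] by (simp add: D_simps)
    then show ?thesis
      using orbit[OF H(1) wx wy] K unfolding x y by blast
  qed
  then show ?thesis using that c(1) by blast
qed

end

section \<open>From orbits to a group of revolution\<close>

text \<open>A D-orthonormal basis of T, together with the direction c of the axis and the origin p, is an
affine coordinate system in which invariance under the orthogonal group is exactly the assumption
that membership in K depends on the position along the axis and the D-length of the rest.\<close>

lemma affine_revolution_bodyI: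
  fixes K T :: "'a::euclidean_space set" and D :: "'a \<Rightarrow> 'a \<Rightarrow> real"
  assumes K: "convex_body K" and m: "m \<ge> 1" and dim_space: "DIM('a) = Suc m"
    and T: "T = {x. x \<bullet> t = 0}" and dT: "dim T = m" and c: "c \<bullet> t = 1"
    and D: "bilinear D" and D_sym: "\<And>x y. D x y = D y x"
    and D_pos: "\<And>x. x \<in> T \<Longrightarrow> x \<noteq> 0 \<Longrightarrow> D x x > 0"
    and orbit: "\<And>s x y. x \<in> T \<Longrightarrow> y \<in> T \<Longrightarrow> D x x = D y y \<Longrightarrow>
      s *\<^sub>R c + x + p \<in> K \<Longrightarrow> s *\<^sub>R c + y + p \<in> K"
  shows "\<exists>A. affine_revolution_body 1 K A \<and> p \<in> A"
proof -
  have sT: "subspace T"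
    unfolding T by (auto simp: subspace_def inner_add_left)
  obtain e where eT: "\<And>i. i < m \<Longrightarrow> e i \<in> T"
    and ee: "\<And>i j. i < m \<Longrightarrow> j < m \<Longrightarrow> D (e i) (e j) = (if i = j then 1 else 0)"
    and eexp: "\<And>x. x \<in> T \<Longrightarrow> x = (\<Sum>i<m. D (e i) x *\<^sub>R e i)"
    using gram_schmidt[OF sT dT D D_sym D_pos] by blast
  have linr: "linear (D y)" for y
    using D by (simp add: bilinear_def)
  have Dsq: "D y y = (\<Sum>i<m. D (e i) y * D (e i) y)" if "y \<in> T" for y
  proof -
    have "D y y = D (\<Sum>i<m. D (e i) y *\<^sub>R e i) y"
      using eexp[OF that] by simp
    then show ?thesis
      unfolding bilinear_left_sum[OF D] .
  qed
  define S where "S z = (z - p) \<bullet> t" for z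
  define Y where "Y z = z - p - S z *\<^sub>R c" for z
  define \<phi> where "\<phi> z = (vec m (\<lambda>i. D (e i) (Y z)), vec 1 (\<lambda>_. S z))" for z
  define \<psi> where "\<psi> vw = p + (snd vw $ 0) *\<^sub>R c + (\<Sum>i<m. (fst vw $ i) *\<^sub>R e i)" for vw :: "real vec \<times> real vec"
  have YT: "Y z \<in> T" for z
    using c by (simp add: T Y_def S_def inner_diff_left)
  have z_eq: "z = S z *\<^sub>R c + Y z + p" for z
    by (simp add: Y_def)
  have sum_T: "(\<Sum>i<m. u i *\<^sub>R e i) \<in> T" for u
    using eT sT by (intro subspace_sum subspace_scale) auto
  have bij: "bij_betw \<phi> UNIV (carrier_vec m \<times> carrier_vec 1)"
  proof (rule bij_betwI[where g = \<psi>])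
    show "\<phi> \<in> UNIV \<rightarrow> carrier_vec m \<times> carrier_vec 1"
      by (auto simp: \<phi>_def)
    show "\<psi> (\<phi> z) = z" for z
    proof -
      have "\<psi> (\<phi> z) = p + S z *\<^sub>R c + (\<Sum>i<m. D (e i) (Y z) *\<^sub>R e i)"
        by (simp add: \<psi>_def \<phi>_def)
      also have "\<dots> = z" using eexp[OF YT, of z] by (simp add: Y_def)
      finally show ?thesis .
    qed
    show "\<phi> (\<psi> vw) = vw" if "vw \<in> carrier_vec m \<times> carrier_vec 1" for vw
    proof -
      obtain v w where vw: "vw = (v, w)"
        by (cases vw)
      have dims: "v \<in> carrier_vec m" "w \<in> carrier_vec 1"
        using that vw by auto
      have "(\<Sum>i<m. (v $ i) *\<^sub>R e i) \<bullet> t = 0"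
        using sum_T[of "\<lambda>i. v $ i"] by (simp add: T)
      then have Sw: "S (\<psi> vw) = w $ 0"
        using c by (simp add: S_def \<psi>_def vw inner_add_left inner_sum_left)
      then have Yv: "Y (\<psi> vw) = (\<Sum>i<m. (v $ i) *\<^sub>R e i)"
        by (simp add: Y_def \<psi>_def vw)
      have "D (e j) (\<Sum>i<m. (v $ i) *\<^sub>R e i) = v $ j" if "j < m" for j
      proof -
        have "D (e j) (\<Sum>i<m. (v $ i) *\<^sub>R e i) = (\<Sum>i<m. v $ i * D (e j) (e i))"
          by (simp add: linear_sum[OF linr] linear_scale[OF linr])
        also have "\<dots> = (\<Sum>i<m. if i = j then v $ j else 0)"
          using ee[OF that] by (intro sum.cong) auto
        finally show ?thesis using that by simp
      qed
      then show ?thesis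
        using dims Sw Yv unfolding vw by (auto simp: \<phi>_def vec_eq_iff)
    qed
  qed auto
  have S_comb: "S ((1 - r) *\<^sub>R x + r *\<^sub>R y) = (1 - r) * S x + r * S y" for x y r
    by (simp add: S_def inner_diff_left inner_add_left algebra_simps)
  have "(1 - r) *\<^sub>R x + r *\<^sub>R y - p = (1 - r) *\<^sub>R (x - p) + r *\<^sub>R (y - p)" for x y r
    by (simp add: algebra_simps)
  then have Y_comb: "Y ((1 - r) *\<^sub>R x + r *\<^sub>R y) = (1 - r) *\<^sub>R Y x + r *\<^sub>R Y y" for x y r
    unfolding Y_def S_comb by (simp add: algebra_simps)
  have iso: "affine_iso UNIV m 1 \<phi>"
    unfolding affine_iso_def affine_vec_on_def using bij
    by (auto simp: \<phi>_def vec_eq_iff S_comb Y_comb bilinear_radd[OF D] bilinear_rmul[OF D])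
  have am: "nat (aff_dim (UNIV::'a set)) - 1 = m"
    using dim_space by simp
  define rot where "rot Q = restrict (the_inv_into UNIV \<phi> \<circ> rotate_fst Q \<circ> \<phi>) UNIV" for Q
  define G where "G = {rot Q | Q. Q \<in> orthogonal_group m}"
  define A where "A = {w \<in> UNIV. fst (\<phi> w) = 0\<^sub>v m}"
  have grp: "affine_revolution_group 1 UNIV G A
      {u - v | u v. u \<in> UNIV \<and> v \<in> UNIV \<and> snd (\<phi> u) = snd (\<phi> v)}"
    unfolding affine_revolution_group_def Let_def am
    using iso dim_space m by (auto intro!: exI[of _ \<phi>] simp: G_def A_def rot_def)
  have \<phi>_rot: "\<phi> (rot Q z) = (Q *\<^sub>v fst (\<phi> z), snd (\<phi> z))" if "Q \<in> orthogonal_group m" for Q z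
  proof -
    have "rotate_fst Q (\<phi> z) \<in> carrier_vec m \<times> carrier_vec 1"
      using that by (auto simp: rotate_fst_def \<phi>_def orthogonal_group_def)
    then have "\<phi> (rot Q z) = rotate_fst Q (\<phi> z)"
      using f_the_inv_into_f_bij_betw[OF bij] by (simp add: rot_def)
    then show ?thesis by (simp add: rotate_fst_def case_prod_beta)
  qed
  have car: "fst (\<phi> z) \<in> carrier_vec m" for z by (simp add: \<phi>_def)
  have norm: "scalar_prod (fst (\<phi> z)) (fst (\<phi> z)) = D (Y z) (Y z)" for z
    unfolding Dsq[OF YT] by (simp add: \<phi>_def scalar_prod_def atLeast0LessThan)
  have rot_K: "rot Q z \<in> K" if Q: "Q \<in> orthogonal_group m" and z: "z \<in> K" for Q z
  proof -
    have "vec 1 (\<lambda>_. S (rot Q z)) = vec 1 (\<lambda>_. S z)"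
      using \<phi>_rot[OF Q, of z] by (simp add: \<phi>_def)
    then have Seq: "S (rot Q z) = S z"
      by (auto simp: vec_eq_iff)
    have "D (Y (rot Q z)) (Y (rot Q z)) = D (Y z) (Y z)"
      using orthogonal_group_scalar_prod[OF Q car] \<phi>_rot[OF Q, of z] norm[of z] norm[of "rot Q z"]
      by simp
    then have "S z *\<^sub>R c + Y (rot Q z) + p \<in> K"
      using orbit[OF YT YT, of z "rot Q z" "S z"] z z_eq[of z] by simp
    then show ?thesis using z_eq[of "rot Q z"] Seq by simp
  qed
  have "rot Q ` K = K" if Q: "Q \<in> orthogonal_group m" for Q
  proof
    show "rot Q ` K \<subseteq> K" using rot_K[OF Q] by blast
    show "K \<subseteq> rot Q ` K"
    proof
      fix z assume z: "z \<in> K"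
      have c: "Q \<in> carrier_mat m m" using Q by (simp add: orthogonal_group_def)
      have Q': "transpose_mat Q \<in> orthogonal_group m"
        using orthogonal_group_transpose[OF Q] c by (simp add: orthogonal_group_def)
      have "Q *\<^sub>v (transpose_mat Q *\<^sub>v fst (\<phi> z)) = fst (\<phi> z)"
        using assoc_mult_mat_vec[of Q m m "transpose_mat Q" m "fst (\<phi> z)"]
          orthogonal_group_transpose[OF Q] c car by simp
      then have "\<phi> (rot Q (rot (transpose_mat Q) z)) = \<phi> z"
        by (simp add: \<phi>_rot[OF Q] \<phi>_rot[OF Q'])
      then have "rot Q (rot (transpose_mat Q) z) = z"
        using bij by (auto simp: bij_betw_def dest: injD)
      then show "z \<in> rot Q ` K" using rot_K[OF Q' z] by (metis image_eqI)
    qed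
  qed
  then have "invariant_under G K"
    by (auto simp: invariant_under_def G_def)
  moreover have "p \<in> A"
  proof -
    have "Y p = 0" by (simp add: Y_def S_def)
    then show ?thesis by (simp add: A_def \<phi>_def bilinear_rzero[OF D] vec_eq_iff)
  qed
  ultimately show ?thesis
    using grp K unfolding affine_revolution_body_def by blast
qed

section \<open>Characterization of bodies of affine 1-revolution\<close>

theorem theorem4:
  fixes K :: "(real ^ 'n) set" and p :: "real ^ 'n" and T :: "(real ^ 'n) set"
    and \<sigma> :: "(real ^ 'n) set \<Rightarrow> (real ^ 'n) set"
  assumes "CARD('n) \<ge> 4"
    and "convex_body K"
    and "p \<in> interior K"
    and "T \<in> Gr (CARD('n) - 1) UNIV"
    and "continuous_map (grassmannian (CARD('n) - 2) T) (grassmannian (CARD('n) - 1) UNIV) \<sigma>"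
    and "\<And>H. H \<in> Gr (CARD('n) - 2) T \<Longrightarrow> \<sigma> H \<inter> T = H"
    and "\<And>H. H \<in> Gr (CARD('n) - 2) T \<Longrightarrow>
      \<exists>G A. affine_revolution_group 1 ((\<lambda>x. x + p) ` \<sigma> H) G A H \<and> p \<in> A \<and>
        invariant_under G (K \<inter> (\<lambda>x. x + p) ` \<sigma> H)"
  shows "\<exists>A. affine_revolution_body 1 K A \<and> p \<in> A"
proof -
  define k where "k = CARD('n) - 2"
  have k: "k \<ge> 2" "DIM(real ^ 'n) = k + 2" "CARD('n) - 1 = Suc k"
    using assms(1) by (auto simp: k_def)
  have T: "subspace T" "dim T = Suc k"
    using assms(4) k by (auto simp: Gr_def)
  have K: "compact K" "convex K"
    using assms(2) by (auto simp: convex_body_def)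
  obtain t where t: "norm t = 1" "T = {x. x \<bullet> t = 0}"
    using hyperplane_unit_normal[OF T(1)] T(2) k by auto
  have \<sigma>_cont: "continuous_map (grassmannian k T) (grassmannian (Suc k) UNIV) \<sigma>"
    using assms(5) k by (simp add: k_def)
  have \<sigma>_Gr: "\<sigma> H \<in> Gr (Suc k) UNIV" if "H \<in> Gr k T" for H
    using continuous_map_image_subset_topspace[OF \<sigma>_cont] that
    by (auto simp: grassmannian_def topspace_pullback_topology)
  have \<sigma>_T: "\<sigma> H \<inter> T = H" if "H \<in> Gr k T" for H
    using assms(6) that by (simp add: k_def)
  have "\<exists>a B. revolved_about K p t (\<sigma> H) H a B" if H: "H \<in> Gr k T" for H
  proof -
    obtain G A where GA: "affine_revolution_group 1 ((\<lambda>x. x + p) ` \<sigma> H) G A H" "p \<in> A"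
      "invariant_under G (K \<inter> (\<lambda>x. x + p) ` \<sigma> H)"
      using assms(7) H unfolding k_def by blast
    have S: "subspace (\<sigma> H)" "dim (\<sigma> H) = Suc k"
      using \<sigma>_Gr[OF H] by (auto simp: Gr_def)
    have H': "subspace H" "dim H = k" using H by (auto simp: Gr_def)
    have "k \<ge> 1" using k by simp
    from normalized_section[OF S this H' \<sigma>_T[OF H, unfolded t(2)] K assms(3) GA]
    show ?thesis .
  qed
  then obtain a B where sec: "\<And>H. H \<in> Gr k T \<Longrightarrow> revolved_about K p t (\<sigma> H) H (a H) (B H)"
    by metis
  have a: "a H \<in> \<sigma> H" "a H \<bullet> t = 1" if "H \<in> Gr k T" for H
    using sec[OF that] unfolding revolved_about_def by blast+
  have B: "bilinear (B H)" "B H x y = B H y x" if "H \<in> Gr k T" for H x y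
    using sec[OF that] unfolding revolved_about_def by blast+
  have B_H: "x \<noteq> 0 \<Longrightarrow> B H x x > 0" "x + p \<in> K \<longleftrightarrow> B H x x \<le> 1" if "H \<in> Gr k T" "x \<in> H" for H x
    using sec[OF that(1)] that(2) unfolding revolved_about_def by blast+
  have B_orbit: "s *\<^sub>R a H + y + p \<in> K"
    if "H \<in> Gr k T" "x \<in> H" "y \<in> H" "B H x x = B H y y" "s *\<^sub>R a H + x + p \<in> K" for H s x y
    using sec[OF that(1)] that(2-) unfolding revolved_about_def by blast
  have trace: "x \<in> {x. x + p \<in> K} \<longleftrightarrow> B H x x \<le> 1" if "H \<in> Gr k T" "x \<in> H" for H x
    using B_H(2)[OF that] by simp
  have "\<exists>D. bilinear D \<and> (\<forall>x y. D x y = D y x) \<and> (\<forall>H\<in>Gr k T. \<forall>x\<in>H. \<forall>y\<in>H. B H x y = D x y)"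
    using T k(1) B B_H(1) trace by (rule ellipsoid_from_sections)
  then obtain D where D': "bilinear D \<and> (\<forall>x y. D x y = D y x) \<and>
      (\<forall>H\<in>Gr k T. \<forall>x\<in>H. \<forall>y\<in>H. B H x y = D x y)"
    by (rule exE)
  note D = D'[THEN conjunct1] D'[THEN conjunct2, THEN conjunct1, rule_format]
    and BD = D'[THEN conjunct2, THEN conjunct2, rule_format]
  have D_pos: "D x x > 0" if x: "x \<in> T" "x \<noteq> 0" for x
  proof -
    obtain H where "H \<in> Gr k T" "x \<in> H"
      using pair_in_hyperplane[OF T k(1) x(1) x(1)] by blast
    then show ?thesis
      using B_H(1)[of H x] BD[of H x x] x(2) by simp
  qed
  interpret R: revolved_sections "{x. x + p \<in> K}" T t k \<sigma> a D
  proof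
    show "bounded {x. x + p \<in> K}" "0 \<in> interior {x. x + p \<in> K}"
      using translated_to_origin[OF K assms(3)] by (simp_all add: compact_imp_bounded)
    show "s *\<^sub>R a H + y \<in> {x. x + p \<in> K}"
      if "H \<in> Gr k T" "x \<in> H" "y \<in> H" "D x x = D y y" "s *\<^sub>R a H + x \<in> {x. x + p \<in> K}" for H x y s
      using B_orbit[OF that(1-3), of s] that(4,5) BD[OF that(1)] that(2,3) by simp
    show "D x y = D y x" for x y
      by (rule D(2))
  qed (fact k(1) k(2) t \<sigma>_Gr \<sigma>_T \<sigma>_cont a D(1) D_pos)+
  obtain c where c: "c \<bullet> t = 1"
    "\<And>s x y. x \<in> T \<Longrightarrow> y \<in> T \<Longrightarrow> D x x = D y y \<Longrightarrow>
      s *\<^sub>R c + x + p \<in> K \<Longrightarrow> s *\<^sub>R c + y + p \<in> K"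
    using R.revolves_about_common_axis unfolding mem_Collect_eq by blast
  show ?thesis
    by (rule affine_revolution_bodyI[OF assms(2) _ _ t(2) T(2) c(1) D D_pos c(2)]) (use k in auto)
qed

end
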